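(* Consider the control system with input $F_0(t)$ and unknown functions $w(x,t)$, $\psi(x,t)$, $x\in[0,\ell]$: $$\rho \ddot w(x,t) - K\big(w''(x,t)-\psi'(x,t)\big)=0,\qquad I_\rho\ddot\psi(x,t)-EI\,\psi''(x,t)-K\big(w'(x,t)-\psi(x,t)\big)=0,\qquad x\ne \ell_0,$$ with boundary conditions $w(0,t)=w(\ell,t)=0$, $\psi'(0,t)=\psi'(\ell,t)=0$ and interface conditions $$w(\ell_0-0,t)=w(\ell_0+0,t),\quad \psi(\ell_0-0,t)=\psi(\ell_0+0,t),\quad \psi'(\ell_0-0,t)=\psi'(\ell_0+0,t),$$ $$F_0-m\ddot w(\ell_0,t)-\varkappa w(\ell_0,t)-d\,\dot w(\ell_0,t)-K\big(w'(\ell_0-0,t)-w'(\ell_0+0,t)\big)=0.$$ Let $\ell_k\in[0,\ell]$, let $\mathcal{E}^x$ and $\mathcal{M}(s)$ be the $4\times4$ matrices defined in the context, and let $S=\{s\in\mathbb{C}\mid \det(\mathcal{M}(s))\neq 0\}$. Then the transfer functions $H_1(s)$ and $H_2(s)$ of this control system with the outputs $y_1(t)=w(\ell_k,t)$ and $y_2(t)=\psi'(\ell_k,t)$, respectively, are defined for all $s\in S$ as follows: $$H_1(s)=\begin{cases}\mathcal{E}^{\ell_k}_{12}\,\mathcal{M}^{-1}_{14}+\mathcal{E}^{\ell_k}_{13}\,\mathcal{M}^{-1}_{24}, & \ell_k\in[0,\ell_0],\\ \mathcal{E}^{\ell_k-\ell}_{12}\,\mathcal{M}^{-1}_{34}+\mathcal{E}^{\ell_k-\ell}_{13}\,\mathcal{M}^{-1}_{44},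 & \ell_k\in(\ell_0,\ell],\end{cases}$$ $$H_2(s)=\begin{cases}\mathcal{E}^{\ell_k}_{42}\,\mathcal{M}^{-1}_{14}+\mathcal{E}^{\ell_k}_{43}\,\mathcal{M}^{-1}_{24}, & \ell_k\in[0,\ell_0],\\ \mathcal{E}^{\ell_k-\ell}_{42}\,\mathcal{M}^{-1}_{34}+\mathcal{E}^{\ell_k-\ell}_{43}\,\mathcal{M}^{-1}_{44}, & \ell_k\in(\ell_0,\ell],\end{cases}$$ where $\mathcal{M}^{-1}_{j4}$, $j=1,\dots,4$, are the entries in the fourth column of the inverse matrix $\mathcal{M}(s)^{-1}$.
   Context: Primes denote $\partial/\partial x$, dots denote $\partial/\partial t$; $f(\ell_0\mp0)$ denote the left/right one-sided limits at $\ell_0$. The parameters are real constants: $\ell>0$ (beam length), $\ell_0\in(0,\ell)$, and positive $\rho$, $I_\rho$, $K$, $EI$ (a product of the two constants $E$, $I$, treated as one constant), $m$, $\varkappa$, $d$. The functions $w,\psi$ are assumed to be of class $C^0$ in $x$ and $C^2$ in $t$, with the weak derivatives appearing in the system. Transfer function. The transfer function with output $y$ is $H(s)=Y(s)/U(s)$, where $U(s)=\int_0^\infty F_0(t)e^{-st}\,dt$ and $Y(s)=\int_0^\infty y(t)e^{-st}\,dt$ are the Laplace transforms of the input and the output under zero initial conditions, with $s\in\mathbb{C}$ the frequency parameter. With $W(x,s)$, $\Psi(x,s)$ the Laplace transforms in $t$ of $w$, $\psi$, the transformed system is, for $x\neq\ell_0$, $$K(W''-\Psi')-\rho s^2W=0,\qquad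 EI\,\Psi''+K(W'-\Psi)-I_\rho s^2\Psi=0,$$ with $W(0,s)=W(\ell,s)=0$, $\Psi'(0,s)=\Psi'(\ell,s)=0$, with $W,\Psi,\Psi'$ continuous at $x=\ell_0$, and $$K\big(W'(\ell_0-0,s)-W'(\ell_0+0,s)\big)+(ms^2+\varkappa+ds)W(\ell_0,s)=U(s).$$ The outputs are $Y_1(s)=W(\ell_k,s)$ and $Y_2(s)=\Psi'(\ell_k,s)$, where $(W,\Psi)$ solves this boundary-value problem, so $H_1=Y_1/U$ and $H_2=Y_2/U$. Matrices. Put $$\mathcal{A}(s)=\begin{pmatrix}0&1&0&0\\ a&0&0&1\\ 0&0&0&1\\ 0&b&c&0\end{pmatrix},\quad a(s)=\frac{\rho s^2}{K},\quad b=-\frac{K}{EI},\quad c(s)=\frac{I_\rho s^2}{EI}-b,$$ and for $x\in\mathbb{R}$ let $\mathcal{E}^x=\mathcal{E}^x(s)=e^{x\mathcal{A}(s)}$ be the matrix exponential, with entries $\mathcal{E}^x_{ij}$. Define $$\mathcal{M}(s)=\begin{pmatrix}\mathcal{E}^{\ell_0}_{12}&\mathcal{E}^{\ell_0}_{13}&-\mathcal{E}^{\ell_0-\ell}_{12}&-\mathcal{E}^{\ell_0-\ell}_{13}\\ \mathcal{E}^{\ell_0}_{32}&\mathcal{E}^{\ell_0}_{33}&-\mathcal{E}^{\ell_0-\ell}_{32}&-\mathcal{E}^{\ell_0-\ell}_{33}\\ \mathcal{E}^{\ell_0}_{42}&\mathcal{E}^{\ell_0}_{43}&-\mathcal{E}^{\ell_0-\ell}_{42}&-\mathcal{E}^{\ell_0-\ell}_{43}\\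 \mathcal{M}_{41}&\mathcal{M}_{42}&-K\mathcal{E}^{\ell_0-\ell}_{22}&-K\mathcal{E}^{\ell_0-\ell}_{23}\end{pmatrix},$$ where $\mathcal{M}_{41}=K\mathcal{E}^{\ell_0}_{22}+(ms^2+\varkappa+ds)\mathcal{E}^{\ell_0}_{12}$ and $\mathcal{M}_{42}=K\mathcal{E}^{\ell_0}_{23}+(ms^2+\varkappa+ds)\mathcal{E}^{\ell_0}_{13}$. *)

theory Defs
  imports "HOL-Analysis.Analysis"
begin

(* Physical constants.  In the usual notation: len = l, pos = l_0, rho, Irho = I_rho, shear = K,
   bend = EI (one constant), mass = m, spring = kappa, damp = d. *)
record beam =
  len :: real
  pos :: real
  rho :: real
  Irho :: real
  shear :: real
  bend :: real
  mass :: real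
  spring :: real
  damp :: real

definition beam_params :: "beam \<Rightarrow> bool" where
  "beam_params B \<longleftrightarrow>
     0 < len B \<and> 0 < pos B \<and> pos B < len B \<and>
     0 < rho B \<and> 0 < Irho B \<and> 0 < shear B \<and> 0 < bend B \<and>
     0 < mass B \<and> 0 < spring B \<and> 0 < damp B"

(* Derivatives in x \<in> [0, l] and in t \<in> [0, \<infinity>), one-sided at the end points of these intervals. *)
definition dx :: "beam \<Rightarrow> (real \<Rightarrow> 'a::real_normed_vector) \<Rightarrow> real \<Rightarrow> 'a" where
  "dx B f x = vector_derivative f (at x within {0..len B})"

definition dt :: "(real \<Rightarrow> 'a::real_normed_vector) \<Rightarrow> real \<Rightarrow> 'a" where
  "dt f t = vector_derivative f (at t within {0..})"

definition twice_diff_off_pos :: "beam \<Rightarrow> (real \<Rightarrow> 'a::real_normed_vector) \<Rightarrow> bool" where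
  "twice_diff_off_pos B f \<longleftrightarrow>
     (\<forall>x\<in>{0..len B} - {pos B}.
        f differentiable (at x within {0..len B}) \<and> dx B f differentiable (at x within {0..len B}))"

definition C2_in_time :: "(real \<Rightarrow> 'a::real_normed_vector) \<Rightarrow> bool" where
  "C2_in_time f \<longleftrightarrow>
     (\<forall>t\<ge>0. f differentiable (at t within {0..}) \<and> dt f differentiable (at t within {0..})) \<and>
     continuous_on {0..} (dt (dt f))"

(* Since w(\<cdot>, t) and psi(\<cdot>, t) are continuous on [0, l], their one-sided limits at l_0 agree with
   their values there; this is the first two interface conditions.  The numbers p and q are the
   one-sided limits w'(l_0 - 0, t) and w'(l_0 + 0, t). *)
definition control_system ::
  "beam \<Rightarrow> (real \<Rightarrow> real) \<Rightarrow> (real \<Rightarrow> real \<Rightarrow> real) \<Rightarrow> (real \<Rightarrow> real \<Rightarrow> real) \<Rightarrow> bool" where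
  "control_system B F0 w \<psi> \<longleftrightarrow>
     (\<forall>x\<in>{0..len B}. C2_in_time (w x) \<and> C2_in_time (\<psi> x)) \<and>
     (\<forall>t\<ge>0.
        let wt = (\<lambda>x. w x t); \<psi>t = (\<lambda>x. \<psi> x t) in
        continuous_on {0..len B} wt \<and> continuous_on {0..len B} \<psi>t \<and>
        twice_diff_off_pos B wt \<and> twice_diff_off_pos B \<psi>t \<and>
        (\<forall>x\<in>{0..len B} - {pos B}.
           rho B * dt (dt (w x)) t - shear B * (dx B (dx B wt) x - dx B \<psi>t x) = 0 \<and>
           Irho B * dt (dt (\<psi> x)) t - bend B * dx B (dx B \<psi>t) x - shear B * (dx B wt x - \<psi> x t) = 0) \<and>
        w 0 t = 0 \<and> w (len B) t = 0 \<and> dx B \<psi>t 0 = 0 \<and> dx B \<psi>t (len B) = 0 \<and>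
        (\<exists>r. (dx B \<psi>t \<longlongrightarrow> r) (at_left (pos B)) \<and> (dx B \<psi>t \<longlongrightarrow> r) (at_right (pos B))) \<and>
        (\<exists>p q. (dx B wt \<longlongrightarrow> p) (at_left (pos B)) \<and> (dx B wt \<longlongrightarrow> q) (at_right (pos B)) \<and>
           F0 t - mass B * dt (dt (w (pos B))) t - spring B * w (pos B) t - damp B * dt (w (pos B)) t
             - shear B * (p - q) = 0))"

definition zero_initial ::
  "beam \<Rightarrow> (real \<Rightarrow> real \<Rightarrow> real) \<Rightarrow> (real \<Rightarrow> real \<Rightarrow> real) \<Rightarrow> bool" where
  "zero_initial B w \<psi> \<longleftrightarrow>
     (\<forall>x\<in>{0..len B}. w x 0 = 0 \<and> dt (w x) 0 = 0 \<and> \<psi> x 0 = 0 \<and> dt (\<psi> x) 0 = 0)"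

definition has_laplace :: "(real \<Rightarrow> real) \<Rightarrow> complex \<Rightarrow> complex \<Rightarrow> bool" where
  "has_laplace f s F \<longleftrightarrow>
     ((\<lambda>t. complex_of_real (f t) * exp (- s * complex_of_real t)) has_integral F) {0..}"

(* The Laplace integrals at s of w, psi and their derivatives converge uniformly in x: exponential
   growth with a rate below Re s.  For w'' and psi'' the bound follows from the equations. *)
definition laplace_growth ::
  "beam \<Rightarrow> complex \<Rightarrow> (real \<Rightarrow> real \<Rightarrow> real) \<Rightarrow> bool" where
  "laplace_growth B s f \<longleftrightarrow>
     (\<exists>C \<sigma>. \<sigma> < Re s \<and>
        (\<forall>t\<ge>0.
           (\<forall>x\<in>{0..len B}.
              \<bar>f x t\<bar> \<le> C * exp (\<sigma> * t) \<and>
              \<bar>dt (f x) t\<bar> \<le> C * exp (\<sigma> * t) \<and>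
              \<bar>dt (dt (f x)) t\<bar> \<le> C * exp (\<sigma> * t)) \<and>
           (\<forall>x\<in>{0..len B} - {pos B}. \<bar>dx B (\<lambda>\<xi>. f \<xi> t) x\<bar> \<le> C * exp (\<sigma> * t))))"

definition transformed_system ::
  "beam \<Rightarrow> complex \<Rightarrow> complex \<Rightarrow> (real \<Rightarrow> complex) \<Rightarrow> (real \<Rightarrow> complex) \<Rightarrow> bool" where
  "transformed_system B s U W \<Psi> \<longleftrightarrow>
     twice_diff_off_pos B W \<and> twice_diff_off_pos B \<Psi> \<and>
     (\<forall>x\<in>{0..len B} - {pos B}.
        of_real (shear B) * (dx B (dx B W) x - dx B \<Psi> x) - of_real (rho B) * s\<^sup>2 * W x = 0 \<and>
        of_real (bend B) * dx B (dx B \<Psi>) x + of_real (shear B) * (dx B W x - \<Psi> x)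
          - of_real (Irho B) * s\<^sup>2 * \<Psi> x = 0) \<and>
     W 0 = 0 \<and> W (len B) = 0 \<and> dx B \<Psi> 0 = 0 \<and> dx B \<Psi> (len B) = 0 \<and>
     isCont W (pos B) \<and> isCont \<Psi> (pos B) \<and> isCont (dx B \<Psi>) (pos B) \<and>
     (\<exists>p q. (dx B W \<longlongrightarrow> p) (at_left (pos B)) \<and> (dx B W \<longlongrightarrow> q) (at_right (pos B)) \<and>
        of_real (shear B) * (p - q)
          + (of_real (mass B) * s\<^sup>2 + of_real (spring B) + of_real (damp B) * s) * W (pos B) = U)"

(* H is the value at s of the transfer function of the output given by y in the time domain and by
   Y in the frequency domain.  First part: the transformed system is solvable, and H = Y/U for all
   of its solutions; this makes sense at every s, also where the Laplace integrals of the
   trajectories diverge.  Second part: H is the quotient of the Laplace transforms of output and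
   input along every trajectory that starts from zero and is Laplace transformable at s. *)
definition has_transfer_value ::
  "beam \<Rightarrow> ((real \<Rightarrow> real \<Rightarrow> real) \<Rightarrow> (real \<Rightarrow> real \<Rightarrow> real) \<Rightarrow> real \<Rightarrow> real)
    \<Rightarrow> ((real \<Rightarrow> complex) \<Rightarrow> (real \<Rightarrow> complex) \<Rightarrow> complex) \<Rightarrow> complex \<Rightarrow> complex \<Rightarrow> bool" where
  "has_transfer_value B y Y s H \<longleftrightarrow>
     (\<forall>U. \<exists>W \<Psi>. transformed_system B s U W \<Psi>) \<and>
     (\<forall>U W \<Psi>. U \<noteq> 0 \<and> transformed_system B s U W \<Psi> \<longrightarrow> H = Y W \<Psi> / U) \<and>
     (\<forall>F0 w \<psi>.
        control_system B F0 w \<psi> \<and> zero_initial B w \<psi> \<and> laplace_growth B s w \<and> laplace_growth B s \<psi> \<longrightarrow>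
        (\<exists>U V. has_laplace F0 s U \<and> has_laplace (y w \<psi>) s V \<and> (U \<noteq> 0 \<longrightarrow> H = V / U)))"

(* Multiplication and exp of the library do not give the matrix exponential: the type
   complex^4^4 carries the componentwise product and is not a Banach algebra instance. *)
definition mat_exp :: "complex^'n^'n \<Rightarrow> complex^'n^'n" where
  "mat_exp A = (\<Sum>n. inverse (fact n) *\<^sub>R (((\<lambda>X. A ** X) ^^ n) (mat 1)))"

definition A_mat :: "beam \<Rightarrow> complex \<Rightarrow> complex^4^4" where
  "A_mat B s =
     (let a = of_real (rho B) * s\<^sup>2 / of_real (shear B);
          b = - of_real (shear B) / of_real (bend B);
          c = of_real (Irho B) * s\<^sup>2 / of_real (bend B) - b
      in vector [vector [0, 1, 0, 0],
                 vector [a, 0, 0, 1],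
                 vector [0, 0, 0, 1],
                 vector [0, b, c, 0]])"

definition E_mat :: "beam \<Rightarrow> complex \<Rightarrow> real \<Rightarrow> complex^4^4" where
  "E_mat B s x = mat_exp (x *\<^sub>R A_mat B s)"

definition M_mat :: "beam \<Rightarrow> complex \<Rightarrow> complex^4^4" where
  "M_mat B s =
     (let P = E_mat B s (pos B);
          Q = E_mat B s (pos B - len B);
          k = of_real (shear B);
          z = of_real (mass B) * s\<^sup>2 + of_real (spring B) + of_real (damp B) * s
      in vector [vector [P$1$2, P$1$3, - Q$1$2, - Q$1$3],
                 vector [P$3$2, P$3$3, - Q$3$2, - Q$3$3],
                 vector [P$4$2, P$4$3, - Q$4$2, - Q$4$3],
                 vector [k * P$2$2 + z * P$1$2, k * P$2$3 + z * P$1$3, - k * Q$2$2, - k * Q$2$3]])"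

definition S_set :: "beam \<Rightarrow> complex set" where
  "S_set B = {s. det (M_mat B s) \<noteq> 0}"

end

theory Submission
  imports Defs
begin

text \<open>
Away from the position of the force, the transformed equations are a linear system \<open>X' = A X\<close> with
constant coefficients for the state \<open>X = (W, W', \<Psi>, \<Psi>')\<close>, so \<open>X\<close> is determined on each side by its
value at the corresponding end of the beam and by the matrix exponential (\<open>linear_ode_unique\<close>).  The
boundary conditions leave two unknowns at each end, namely \<open>W'\<close> and \<open>\<Psi>\<close>.  The four interface
conditions are four linear equations for these four unknowns with matrix \<open>M\<close> and right-hand side
\<open>(0, 0, 0, U)\<close> (\<open>transformed_system_solution\<close>).  If \<open>det M\<close> does not vanish, the unknowns are \<open>U\<close>
times the fourth column of the inverse of \<open>M\<close>, which gives the formulas for \<open>W\<close> and \<open>\<Psi>'\<close>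
(\<open>transformed_system_outputs\<close>); conversely, these unknowns define a solution
(\<open>transformed_system_exists\<close>).

It remains to show that the Laplace transforms of a trajectory solve the transformed system, with the
transform of the input as the forcing term (\<open>transforms_solve_transformed_system\<close>).  Since all
functions involved are bounded by a multiple of \<open>exp (\<sigma> t)\<close> with \<open>\<sigma> < Re s\<close>, limits and derivatives
in \<open>x\<close> can be interchanged with the Laplace integral by dominated convergence
(\<open>laplace_dominated_convergence\<close>, \<open>laplace_has_vector_derivative\<close>), and derivatives in \<open>t\<close> become
factors \<open>s\<close> by integration by parts (\<open>laplace_derivative\<close>).  The delicate point is the position of
the force: there \<open>w'\<close> has only one-sided limits, whereas \<open>\<psi>\<close> turns out to be differentiable.
\<close>

section \<open>Derivatives as limits of difference quotients\<close>

text \<open>The states of the beam are complex-valued functions of a real position, so their derivatives are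
vector derivatives.  As limits of difference quotients they can be glued along unions of intervals
and interchanged with Laplace integrals by dominated convergence.\<close>

lemma has_vector_derivative_iff_quotient:
  "(f has_vector_derivative D) (at x within T) \<longleftrightarrow>
     ((\<lambda>y. inverse (y - x) *\<^sub>R (f y - f x)) \<longlongrightarrow> D) (at x within T)"
proof -
  have "(f has_vector_derivative D) (at x within T) \<longleftrightarrow>
      ((\<lambda>y. norm (f y - f x - (y - x) *\<^sub>R D) / norm (y - x)) \<longlongrightarrow> 0) (at x within T)"
    by (simp add: has_vector_derivative_def has_derivative_iff_norm bounded_linear_scaleR_left)
  also have "\<dots> \<longleftrightarrow> ((\<lambda>y. norm (inverse (y - x) *\<^sub>R (f y - f x) - D)) \<longlongrightarrow> 0) (at x within T)"
  proof (rule filterlim_cong [OF refl refl])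
    have "norm (f y - f x - (y - x) *\<^sub>R D) / norm (y - x) = norm (inverse (y - x) *\<^sub>R (f y - f x) - D)"
      if "y \<noteq> x" for y
    proof -
      have "inverse (y - x) *\<^sub>R (f y - f x) - D = inverse (y - x) *\<^sub>R (f y - f x - (y - x) *\<^sub>R D)"
        using that by (simp add: scaleR_diff_right)
      then show ?thesis
        by (simp add: divide_inverse mult.commute)
    qed
    then show "\<forall>\<^sub>F y in at x within T. norm (f y - f x - (y - x) *\<^sub>R D) / norm (y - x)
        = norm (inverse (y - x) *\<^sub>R (f y - f x) - D)"
      by (simp add: eventually_at_filter)
  qed
  finally show ?thesis
    by (simp add: tendsto_norm_zero_iff LIM_zero_iff)
qed

lemma has_vector_derivative_Un:
  "(f has_vector_derivative D) (at x within S) \<Longrightarrow> (f has_vector_derivative D) (at x within T) \<Longrightarrow>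
     (f has_vector_derivative D) (at x within (S \<union> T))"
  unfolding has_vector_derivative_iff_quotient by (rule Lim_Un)

section \<open>Entries of the matrix exponential\<close>

definition mat_pow :: "complex^'n^'n \<Rightarrow> nat \<Rightarrow> complex^'n^'n" where
  "mat_pow A n = ((\<lambda>X. A ** X) ^^ n) (mat 1)"

lemma mat_pow_0 [simp]: "mat_pow A 0 = mat 1"
  by (simp add: mat_pow_def)

lemma mat_pow_Suc: "mat_pow A (Suc n) = A ** mat_pow A n"
  by (simp add: mat_pow_def)

lemma mat_pow_Suc_right: "mat_pow A (Suc n) = mat_pow A n ** A"
proof (induction n)
  case 0
  show ?case by (simp add: mat_pow_Suc)
next
  case (Suc n)
  then show ?case by (metis mat_pow_Suc matrix_mul_assoc)
qed

lemma mat_pow_scaleR: "mat_pow (x *\<^sub>R A) n = x ^ n *\<^sub>R mat_pow A n"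
proof (induction n)
  case (Suc n)
  then show ?case
    by (simp add: mat_pow_Suc vec_eq_iff matrix_matrix_mult_def scaleR_sum_right algebra_simps)
qed simp

text \<open>The sum of the moduli of all entries bounds every row sum, so it grows by at most one factor per
multiplication.  This crude bound already lets the exponential series majorize every entry of the
matrix exponential.\<close>

lemma norm_mat_pow_entry_le:
  fixes A :: "complex^'n^'n"
  shows "norm (mat_pow A n $ i $ j) \<le> (\<Sum>k\<in>UNIV. \<Sum>l\<in>UNIV. norm (A $ k $ l)) ^ n"
proof (induction n arbitrary: i)
  case 0
  show ?case by (simp add: mat_def)
next
  case (Suc n)
  let ?K = "\<Sum>k\<in>UNIV. \<Sum>l\<in>UNIV. norm (A $ k $ l)"
  have "norm (mat_pow A (Suc n) $ i $ j) \<le> (\<Sum>k\<in>UNIV. norm (A $ i $ k) * norm (mat_pow A n $ k $ j))"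
    unfolding mat_pow_Suc matrix_matrix_mult_def
    by (simp add: norm_mult [symmetric] norm_sum)
  also have "\<dots> \<le> (\<Sum>k\<in>UNIV. norm (A $ i $ k) * ?K ^ n)"
    by (intro sum_mono mult_left_mono Suc.IH) auto
  also have "\<dots> = (\<Sum>k\<in>UNIV. norm (A $ i $ k)) * ?K ^ n"
    by (simp add: sum_distrib_right)
  also have "\<dots> \<le> ?K * ?K ^ n"
  proof (rule mult_right_mono)
    show "(\<Sum>k\<in>UNIV. norm (A $ i $ k)) \<le> ?K"
      by (rule member_le_sum) (auto intro: sum_nonneg)
    show "0 \<le> ?K ^ n"
      by (intro zero_le_power sum_nonneg) auto
  qed
  finally show ?case by simp
qed

definition exp_coeff :: "complex^'n^'n \<Rightarrow> 'n \<Rightarrow> 'n \<Rightarrow> nat \<Rightarrow> complex" where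
  "exp_coeff A i j n = mat_pow A n $ i $ j / fact n"

lemma summable_exp_coeff:
  fixes A :: "complex^'n^'n" and z :: complex
  shows "summable (\<lambda>n. exp_coeff A i j n * z ^ n)"
proof (rule summable_comparison_test')
  let ?K = "\<Sum>k\<in>UNIV. \<Sum>l\<in>UNIV. norm (A $ k $ l)"
  show "summable (\<lambda>n. inverse (fact n) * (?K * norm z) ^ n)"
    by (rule summable_exp)
  fix n :: nat
  have "norm (exp_coeff A i j n * z ^ n) = norm (mat_pow A n $ i $ j) * (norm z ^ n / fact n)"
    by (simp add: exp_coeff_def norm_mult norm_divide norm_power)
  also have "\<dots> \<le> ?K ^ n * (norm z ^ n / fact n)"
    by (intro mult_right_mono norm_mat_pow_entry_le) auto
  finally show "norm (exp_coeff A i j n * z ^ n) \<le> inverse (fact n) * (?K * norm z) ^ n"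
    by (simp add: power_mult_distrib field_simps)
qed

text \<open>Each entry of the matrix exponential is an everywhere convergent power series in the scalar factor,
so the calculus of the matrix exponential reduces to termwise differentiation of power series.\<close>

lemma mat_exp_entry:
  fixes A :: "complex^'n^'n"
  shows "mat_exp (x *\<^sub>R A) $ i $ j = (\<Sum>n. exp_coeff A i j n * of_real x ^ n)"
proof -
  let ?f = "\<lambda>n. inverse (fact n) *\<^sub>R mat_pow (x *\<^sub>R A) n"
  let ?S = "\<chi> i j. \<Sum>n. exp_coeff A i j n * of_real x ^ n"
  have "?f sums ?S"
    unfolding sums_def
  proof (intro vec_tendstoI)
    fix i j
    have "?f n $ i $ j = exp_coeff A i j n * of_real x ^ n" for n
      by (simp add: mat_pow_scaleR exp_coeff_def scaleR_conv_of_real [where 'a = complex] divide_inverse)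
    then show "(\<lambda>n. (\<Sum>k<n. ?f k) $ i $ j) \<longlonglongrightarrow> ?S $ i $ j"
      using summable_sums [OF summable_exp_coeff [of A i j "of_real x"]]
      by (simp add: sums_def)
  qed
  then have "mat_exp (x *\<^sub>R A) = ?S"
    unfolding mat_exp_def mat_pow_def by (rule sums_unique [symmetric])
  then show ?thesis by simp
qed

lemma mat_exp_0: "mat_exp (0 *\<^sub>R (A :: complex^'n^'n)) = mat 1"
proof -
  have "mat_exp (0 *\<^sub>R A) $ i $ j = mat 1 $ i $ j" for i j
    unfolding mat_exp_entry of_real_0 powser_zero by (simp add: exp_coeff_def)
  then show ?thesis by (simp add: vec_eq_iff)
qed

text \<open>The two ways of splitting one factor off a power give the same coefficients.  Together with the next
lemma this provides the derivative in the form with \<open>A\<close> on the right, which the uniqueness proof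
below uses.\<close>

lemma mat_exp_commute:
  fixes A :: "complex^'n^'n"
  shows "A ** mat_exp (x *\<^sub>R A) = mat_exp (x *\<^sub>R A) ** A"
proof -
  have "(A ** mat_exp (x *\<^sub>R A)) $ i $ j = (mat_exp (x *\<^sub>R A) ** A) $ i $ j" for i j
  proof -
    let ?z = "of_real x :: complex"
    have *: "(\<Sum>k\<in>UNIV. A $ i $ k * exp_coeff A k j n) = (\<Sum>k\<in>UNIV. exp_coeff A i k n * A $ k $ j)" for n
      using arg_cong [OF mat_pow_Suc_right [of A n], of "\<lambda>M. M $ i $ j / fact n"]
      unfolding mat_pow_Suc by (simp add: matrix_matrix_mult_def exp_coeff_def sum_divide_distrib)
    have "(A ** mat_exp (x *\<^sub>R A)) $ i $ j = (\<Sum>k\<in>UNIV. A $ i $ k * (\<Sum>n. exp_coeff A k j n * ?z ^ n))"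
      by (simp add: matrix_matrix_mult_def mat_exp_entry)
    also have "\<dots> = (\<Sum>n. (\<Sum>k\<in>UNIV. A $ i $ k * (exp_coeff A k j n * ?z ^ n)))"
      by (subst suminf_sum) (auto intro!: summable_mult summable_exp_coeff simp: suminf_mult summable_exp_coeff)
    also have "\<dots> = (\<Sum>n. (\<Sum>k\<in>UNIV. (exp_coeff A i k n * ?z ^ n) * A $ k $ j))"
    proof (rule suminf_cong)
      fix n
      show "(\<Sum>k\<in>UNIV. A $ i $ k * (exp_coeff A k j n * ?z ^ n)) = (\<Sum>k\<in>UNIV. (exp_coeff A i k n * ?z ^ n) * A $ k $ j)"
        using arg_cong [OF * [of n], of "\<lambda>u. u * ?z ^ n"]
        unfolding sum_distrib_right by (simp only: mult_ac)
    qed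
    also have "\<dots> = (\<Sum>k\<in>UNIV. (\<Sum>n. exp_coeff A i k n * ?z ^ n) * A $ k $ j)"
      by (subst suminf_sum) (auto intro!: summable_mult2 summable_exp_coeff simp: suminf_mult2 [symmetric] summable_exp_coeff)
    also have "\<dots> = (mat_exp (x *\<^sub>R A) ** A) $ i $ j"
      by (simp add: matrix_matrix_mult_def mat_exp_entry)
    finally show ?thesis .
  qed
  then show ?thesis by (simp add: vec_eq_iff)
qed

text \<open>Differentiating the series shifts its coefficients: the factor \<open>n + 1\<close> cancels against the
factorial, and the additional power of \<open>A\<close> splits off to the left.\<close>

lemma mat_exp_entry_has_vector_derivative:
  fixes A :: "complex^'n^'n"
  shows "((\<lambda>x. mat_exp (x *\<^sub>R A) $ i $ j) has_vector_derivative (A ** mat_exp (x *\<^sub>R A)) $ i $ j)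
           (at x within T)"
proof -
  let ?z = "of_real x :: complex"
  have diffs: "diffs (exp_coeff A i j) n = (\<Sum>k\<in>UNIV. A $ i $ k * exp_coeff A k j n)" for n
  proof -
    have "diffs (exp_coeff A i j) n = mat_pow A (Suc n) $ i $ j / fact n"
      by (simp add: diffs_def exp_coeff_def del: of_nat_Suc)
    then show ?thesis
      by (simp add: exp_coeff_def mat_pow_Suc matrix_matrix_mult_def sum_divide_distrib)
  qed
  have "(\<Sum>n. diffs (exp_coeff A i j) n * ?z ^ n) = (\<Sum>n. \<Sum>k\<in>UNIV. A $ i $ k * (exp_coeff A k j n * ?z ^ n))"
    by (simp add: diffs sum_distrib_right mult.assoc)
  also have "\<dots> = (\<Sum>k\<in>UNIV. A $ i $ k * (\<Sum>n. exp_coeff A k j n * ?z ^ n))"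
    by (subst suminf_sum) (auto intro!: summable_mult summable_exp_coeff simp: suminf_mult summable_exp_coeff)
  also have "\<dots> = (A ** mat_exp (x *\<^sub>R A)) $ i $ j"
    by (simp add: matrix_matrix_mult_def mat_exp_entry)
  finally have "(\<Sum>n. diffs (exp_coeff A i j) n * ?z ^ n) = (A ** mat_exp (x *\<^sub>R A)) $ i $ j" .
  moreover have "((\<lambda>z. \<Sum>n. exp_coeff A i j n * z ^ n) has_field_derivative
      (\<Sum>n. diffs (exp_coeff A i j) n * ?z ^ n)) (at ?z)"
    by (rule termdiffs_strong_converges_everywhere) (rule summable_exp_coeff)
  ultimately show ?thesis
    unfolding mat_exp_entry using has_vector_derivative_real_field by fastforce
qed

section \<open>Linear systems with constant coefficients\<close>

definition solves_linear_ode :: "complex^'n^'n \<Rightarrow> real set \<Rightarrow> (real \<Rightarrow> complex^'n) \<Rightarrow> bool" where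
  "solves_linear_ode A T X \<longleftrightarrow>
     (\<forall>x\<in>T. \<forall>i. ((\<lambda>y. X y $ i) has_vector_derivative (A *v X x) $ i) (at x within T))"

lemma mat_exp_solves_linear_ode:
  "solves_linear_ode A T (\<lambda>x. mat_exp ((x - x\<^sub>0) *\<^sub>R A) *v v)"
  unfolding solves_linear_ode_def
proof (intro ballI allI)
  fix x i
  have chain: "((\<lambda>y. mat_exp ((y - x\<^sub>0) *\<^sub>R A) $ i $ j) has_vector_derivative
      (A ** mat_exp ((x - x\<^sub>0) *\<^sub>R A)) $ i $ j) (at x within T)" for j
  proof -
    have "((\<lambda>y. y - x\<^sub>0) has_vector_derivative 1) (at x within T)"
      by (auto intro!: derivative_eq_intros)
    from vector_diff_chain_within [OF this mat_exp_entry_has_vector_derivative [of A i j "x - x\<^sub>0"]]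
    show ?thesis by (simp add: o_def)
  qed
  show "((\<lambda>y. (mat_exp ((y - x\<^sub>0) *\<^sub>R A) *v v) $ i) has_vector_derivative
      (A *v (mat_exp ((x - x\<^sub>0) *\<^sub>R A) *v v)) $ i) (at x within T)"
    unfolding matrix_vector_mul_assoc
    unfolding matrix_vector_mult_def vec_lambda_beta
    by (intro has_vector_derivative_sum has_vector_derivative_mult_left chain)
qed

text \<open>For fixed \<open>x\<close> the function that sends \<open>y\<close> to \<open>exp ((x - y) A) X(y)\<close> has derivative
\<open>- exp ((x - y) A) A X(y) + exp ((x - y) A) A X(y) = 0\<close>, so it takes the same value at \<open>x\<close> and
at \<open>x\<^sub>0\<close>.  Any convex \<open>T\<close> will do, in particular the
half-open intervals on either side of the force.\<close>

lemma linear_ode_unique: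
  assumes X: "solves_linear_ode A T X" and T: "convex T" "x\<^sub>0 \<in> T" "x \<in> T"
  shows "X x = mat_exp ((x - x\<^sub>0) *\<^sub>R A) *v X x\<^sub>0"
proof -
  have "(mat_exp ((x - x) *\<^sub>R A) *v X x) $ i = (mat_exp ((x - x\<^sub>0) *\<^sub>R A) *v X x\<^sub>0) $ i" for i
  proof -
    let ?\<Phi> = "\<lambda>y. mat_exp ((x - y) *\<^sub>R A)"
    let ?g = "\<lambda>y. (?\<Phi> y *v X y) $ i"
    have "(?g has_vector_derivative 0) (at y within T)" if "y \<in> T" for y
    proof -
      have d1: "((\<lambda>y. ?\<Phi> y $ i $ j) has_vector_derivative - ((?\<Phi> y ** A) $ i $ j)) (at y within T)" for j
      proof -
        have "((\<lambda>y. x - y) has_vector_derivative -1) (at y within T)"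
          by (auto intro!: derivative_eq_intros)
        from vector_diff_chain_within [OF this mat_exp_entry_has_vector_derivative [of A i j "x - y"]]
        show ?thesis by (simp add: o_def mat_exp_commute)
      qed
      have d2: "((\<lambda>y. X y $ j) has_vector_derivative (A *v X y) $ j) (at y within T)" for j
        using X that by (simp add: solves_linear_ode_def)
      have "(?g has_vector_derivative
          (\<Sum>j\<in>UNIV. ?\<Phi> y $ i $ j * (A *v X y) $ j + - ((?\<Phi> y ** A) $ i $ j) * X y $ j)) (at y within T)"
        unfolding matrix_vector_mult_def [of "?\<Phi> _"] vec_lambda_beta
        by (intro has_vector_derivative_sum has_vector_derivative_mult d1 d2)
      moreover have "(\<Sum>j\<in>UNIV. ?\<Phi> y $ i $ j * (A *v X y) $ j + - ((?\<Phi> y ** A) $ i $ j) * X y $ j)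
          = (?\<Phi> y *v (A *v X y)) $ i - ((?\<Phi> y ** A) *v X y) $ i"
        by (simp add: matrix_vector_mult_def [of "?\<Phi> y"] matrix_vector_mult_def [of "?\<Phi> y ** A"]
            sum_subtractf)
      ultimately show ?thesis by (simp add: matrix_vector_mul_assoc)
    qed
    with T(1) obtain c where "\<And>y. y \<in> T \<Longrightarrow> ?g y = c"
      using has_vector_derivative_zero_constant [of T ?g] by blast
    with T show ?thesis by blast
  qed
  then have "mat_exp (0 *\<^sub>R A) *v X x = mat_exp ((x - x\<^sub>0) *\<^sub>R A) *v X x\<^sub>0"
    by (simp add: vec_eq_iff)
  then show ?thesis by (simp only: mat_exp_0 matrix_vector_mul_lid)
qed

section \<open>The transformed system as a linear first-order system\<close>

lemma vector_4 [simp]: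
  "(vector [a, b, c, d] :: 'a::zero^4) $ 1 = a"
  "(vector [a, b, c, d] :: 'a::zero^4) $ 2 = b"
  "(vector [a, b, c, d] :: 'a::zero^4) $ 3 = c"
  "(vector [a, b, c, d] :: 'a::zero^4) $ 4 = d"
  by (simp_all add: vector_def)

lemma mat_vec_mult_4:
  fixes A :: "complex^4^4"
  shows "(A *v X) $ i = A $ i $ 1 * X $ 1 + A $ i $ 2 * X $ 2 + A $ i $ 3 * X $ 3 + A $ i $ 4 * X $ 4"
  by (simp add: matrix_vector_mult_def sum_4)

lemma A_mat_mult:
  "(A_mat B s *v X) $ 1 = X $ 2"
  "(A_mat B s *v X) $ 2 = of_real (rho B) * s\<^sup>2 / of_real (shear B) * X $ 1 + X $ 4"
  "(A_mat B s *v X) $ 3 = X $ 4"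
  "(A_mat B s *v X) $ 4 = - of_real (shear B) / of_real (bend B) * X $ 2
     + (of_real (Irho B) * s\<^sup>2 / of_real (bend B) + of_real (shear B) / of_real (bend B)) * X $ 3"
  by (simp_all add: mat_vec_mult_4 A_mat_def Let_def)

definition state :: "beam \<Rightarrow> (real \<Rightarrow> complex) \<Rightarrow> (real \<Rightarrow> complex) \<Rightarrow> real \<Rightarrow> complex^4" where
  "state B W \<Psi> x = vector [W x, dx B W x, \<Psi> x, dx B \<Psi> x]"

lemma state_nth [simp]:
  "state B W \<Psi> x $ 1 = W x" "state B W \<Psi> x $ 2 = dx B W x"
  "state B W \<Psi> x $ 3 = \<Psi> x" "state B W \<Psi> x $ 4 = dx B \<Psi> x"
  by (simp_all add: state_def)

lemma has_vector_derivative_dx: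
  "f differentiable (at x within {0..len B}) \<Longrightarrow> (f has_vector_derivative dx B f x) (at x within {0..len B})"
  unfolding dx_def using vector_derivative_works by blast

lemma dx_eqI:
  assumes "0 < len B" "x \<in> {0..len B}" "(f has_vector_derivative D) (at x within {0..len B})"
  shows "dx B f x = D"
  unfolding dx_def
  using vector_derivative_within_cbox [of 0 "len B" x f D] assms by simp

text \<open>With the state \<open>(W, W', \<Psi>, \<Psi>')\<close> and both equations solved for the second derivatives, the
coefficient matrix of the resulting first-order system is \<open>A_mat\<close>.\<close>

lemma state_solves_linear_ode:
  assumes B: "beam_params B" and sys: "transformed_system B s U W \<Psi>"
    and T: "T \<subseteq> {0..len B} - {pos B}"
  shows "solves_linear_ode (A_mat B s) T (state B W \<Psi>)"
  unfolding solves_linear_ode_def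
proof
  fix x assume x: "x \<in> T"
  have pos: "shear B \<noteq> 0" "bend B \<noteq> 0" using B by (auto simp: beam_params_def)
  have deriv: "(f has_vector_derivative dx B f x) (at x within T)"
    if "f differentiable (at x within {0..len B})" for f :: "real \<Rightarrow> complex"
    using has_vector_derivative_dx [OF that] T by (blast intro: has_vector_derivative_within_subset)
  have "W differentiable (at x within {0..len B})" "\<Psi> differentiable (at x within {0..len B})"
    "dx B W differentiable (at x within {0..len B})" "dx B \<Psi> differentiable (at x within {0..len B})"
    using sys T x by (auto simp: transformed_system_def twice_diff_off_pos_def)
  note derivs = this [THEN deriv]
  have e1: "of_real (shear B) * (dx B (dx B W) x - dx B \<Psi> x) - of_real (rho B) * s\<^sup>2 * W x = 0"
    and e2: "of_real (bend B) * dx B (dx B \<Psi>) x + of_real (shear B) * (dx B W x - \<Psi> x)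
          - of_real (Irho B) * s\<^sup>2 * \<Psi> x = 0"
    using sys T x by (auto simp: transformed_system_def)
  have "dx B (dx B W) x = of_real (rho B) * s\<^sup>2 / of_real (shear B) * W x + dx B \<Psi> x"
    using e1 pos by (simp add: field_simps)
  moreover have "dx B (dx B \<Psi>) x = - of_real (shear B) / of_real (bend B) * dx B W x
       + (of_real (Irho B) * s\<^sup>2 / of_real (bend B) + of_real (shear B) / of_real (bend B)) * \<Psi> x"
  proof -
    have "dx B (dx B \<Psi>) x = (of_real (Irho B) * s\<^sup>2 * \<Psi> x - of_real (shear B) * (dx B W x - \<Psi> x)) / of_real (bend B)"
      using e2 pos by (simp add: eq_divide_eq algebra_simps)
    then show ?thesis by (simp add: diff_divide_distrib add_divide_distrib algebra_simps)
  qed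
  ultimately show "\<forall>i. ((\<lambda>y. state B W \<Psi> y $ i) has_vector_derivative (A_mat B s *v state B W \<Psi> x) $ i) (at x within T)"
    using derivs by (simp add: forall_4 A_mat_mult)
qed

text \<open>A component of a solution that has a limit at a boundary point of its domain attains there the
value predicted by the exponential formula.  At the position of the force the system gives only such
limits, because the derivative of \<open>W\<close> jumps there.\<close>

lemma linear_ode_boundary_value:
  assumes X: "solves_linear_ode A T X" and T: "convex T" "x\<^sub>0 \<in> T" and nontriv: "at x within T \<noteq> bot"
    and lim: "((\<lambda>y. X y $ i) \<longlongrightarrow> c) (at x within T)"
  shows "c = (mat_exp ((x - x\<^sub>0) *\<^sub>R A) *v X x\<^sub>0) $ i"
proof (rule tendsto_unique [OF nontriv lim])
  let ?Y = "\<lambda>y. mat_exp ((y - x\<^sub>0) *\<^sub>R A) *v X x\<^sub>0"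
  have "((\<lambda>y. ?Y y $ i) has_vector_derivative (A *v ?Y x) $ i) (at x)"
    using mat_exp_solves_linear_ode [of A UNIV] by (auto simp: solves_linear_ode_def)
  then have "isCont (\<lambda>y. ?Y y $ i) x"
    by (rule has_vector_derivative_continuous)
  then have "((\<lambda>y. ?Y y $ i) \<longlongrightarrow> ?Y x $ i) (at x within T)"
    using continuous_at_imp_continuous_at_within continuous_within by blast
  then show "((\<lambda>y. X y $ i) \<longlongrightarrow> ?Y x $ i) (at x within T)"
  proof (rule Lim_transform_within [of _ _ _ _ 1])
    fix y assume "y \<in> T"
    then show "?Y y $ i = X y $ i" using linear_ode_unique [OF X T] by simp
  qed simp
qed

text \<open>The boundary conditions annihilate the first and fourth component of the state at both ends, so two
unknowns remain at each end and only the second and third column of the exponential act.  Propagating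
these states to the position of the force, from the left end over \<open>pos B\<close> and from the right end over
\<open>pos B - len B\<close>, turns the interface conditions into four linear equations: continuity of
\<open>W\<close>, \<open>\<Psi>\<close> and \<open>\<Psi>'\<close>, and the jump of \<open>W'\<close>.  Their matrix is \<open>M_mat\<close>.  Since \<open>W\<close> and
\<open>\<Psi>'\<close> are continuous, at the position of the force itself both formulas hold.\<close>

lemma transformed_system_solution:
  assumes B: "beam_params B" and sys: "transformed_system B s U W \<Psi>"
  defines "v \<equiv> vector [dx B W 0, \<Psi> 0, dx B W (len B), \<Psi> (len B)] :: complex^4"
  shows "M_mat B s *v v = vector [0, 0, 0, U]"
    and "x \<in> {0..pos B} \<Longrightarrow> W x = E_mat B s x $ 1 $ 2 * v $ 1 + E_mat B s x $ 1 $ 3 * v $ 2"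
    and "x \<in> {0..pos B} \<Longrightarrow> dx B \<Psi> x = E_mat B s x $ 4 $ 2 * v $ 1 + E_mat B s x $ 4 $ 3 * v $ 2"
    and "x \<in> {pos B..len B} \<Longrightarrow>
      W x = E_mat B s (x - len B) $ 1 $ 2 * v $ 3 + E_mat B s (x - len B) $ 1 $ 3 * v $ 4"
    and "x \<in> {pos B..len B} \<Longrightarrow>
      dx B \<Psi> x = E_mat B s (x - len B) $ 4 $ 2 * v $ 3 + E_mat B s (x - len B) $ 4 $ 3 * v $ 4"
proof -
  let ?l = "len B" and ?a = "pos B" and ?X = "state B W \<Psi>"
  let ?E = "E_mat B s"
  have l: "0 < ?a" "?a < ?l" using B by (auto simp: beam_params_def)
  obtain p q where p: "(dx B W \<longlongrightarrow> p) (at_left ?a)" and q: "(dx B W \<longlongrightarrow> q) (at_right ?a)"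
    and jump: "of_real (shear B) * (p - q)
          + (of_real (mass B) * s\<^sup>2 + of_real (spring B) + of_real (damp B) * s) * W ?a = U"
    using sys unfolding transformed_system_def by blast
  have bc: "W 0 = 0" "W ?l = 0" "dx B \<Psi> 0 = 0" "dx B \<Psi> ?l = 0"
    and cont: "isCont W ?a" "isCont \<Psi> ?a" "isCont (dx B \<Psi>) ?a"
    using sys unfolding transformed_system_def by blast+
  have cont_lim: "(f \<longlongrightarrow> f ?a) (at ?a within T)" if "isCont f ?a" for f :: "real \<Rightarrow> complex" and T
    using that continuous_at_imp_continuous_at_within continuous_within by blast

  have solL: "solves_linear_ode (A_mat B s) {0..<?a} ?X"
    and solR: "solves_linear_ode (A_mat B s) {?a<..?l} ?X"
    using l by (auto intro!: state_solves_linear_ode [OF B sys])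
  have ntL: "at ?a within {0..<?a} \<noteq> bot" and ntR: "at ?a within {?a<..?l} \<noteq> bot"
    using l by (auto simp: at_within_eq_bot_iff)
  have leL: "at ?a within {0..<?a} \<le> at_left ?a" and leR: "at ?a within {?a<..?l} \<le> at_right ?a"
    by (auto intro!: at_le)

  have X0: "?X 0 = vector [0, v $ 1, v $ 2, 0]" and Xl: "?X ?l = vector [0, v $ 3, v $ 4, 0]"
    by (simp_all add: state_def bc v_def)
  have L: "?X x = ?E x *v ?X 0" if "x \<in> {0..<?a}" for x
    using linear_ode_unique [OF solL, of 0 x] that l by (simp add: E_mat_def)
  have R: "?X x = ?E (x - ?l) *v ?X ?l" if "x \<in> {?a<..?l}" for x
    using linear_ode_unique [OF solR, of ?l x] that l by (simp add: E_mat_def)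
  have limL: "c = (?E ?a *v ?X 0) $ i" if "((\<lambda>y. ?X y $ i) \<longlongrightarrow> c) (at ?a within {0..<?a})" for c i
    using linear_ode_boundary_value [OF solL _ _ ntL that, of 0] l by (simp add: E_mat_def)
  have limR: "c = (?E (?a - ?l) *v ?X ?l) $ i" if "((\<lambda>y. ?X y $ i) \<longlongrightarrow> c) (at ?a within {?a<..?l})" for c i
    using linear_ode_boundary_value [OF solR _ _ ntR that, of ?l] l by (simp add: E_mat_def)
  have boundaryL: "W ?a = (?E ?a *v ?X 0) $ 1" "p = (?E ?a *v ?X 0) $ 2"
    "\<Psi> ?a = (?E ?a *v ?X 0) $ 3" "dx B \<Psi> ?a = (?E ?a *v ?X 0) $ 4"
    by (rule limL, simp add: cont cont_lim tendsto_mono [OF leL p])+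
  have boundaryR: "W ?a = (?E (?a - ?l) *v ?X ?l) $ 1" "q = (?E (?a - ?l) *v ?X ?l) $ 2"
    "\<Psi> ?a = (?E (?a - ?l) *v ?X ?l) $ 3" "dx B \<Psi> ?a = (?E (?a - ?l) *v ?X ?l) $ 4"
    by (rule limR, simp add: cont cont_lim tendsto_mono [OF leR q])+

  show "x \<in> {0..?a} \<Longrightarrow> W x = ?E x $ 1 $ 2 * v $ 1 + ?E x $ 1 $ 3 * v $ 2"
    using boundaryL(1) arg_cong [OF L [of x], of "\<lambda>X. X $ 1"] unfolding X0
    by (cases "x = ?a") (auto simp: mat_vec_mult_4)
  show "x \<in> {0..?a} \<Longrightarrow> dx B \<Psi> x = ?E x $ 4 $ 2 * v $ 1 + ?E x $ 4 $ 3 * v $ 2"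
    using boundaryL(4) arg_cong [OF L [of x], of "\<lambda>X. X $ 4"] unfolding X0
    by (cases "x = ?a") (auto simp: mat_vec_mult_4)
  show "x \<in> {?a..?l} \<Longrightarrow> W x = ?E (x - ?l) $ 1 $ 2 * v $ 3 + ?E (x - ?l) $ 1 $ 3 * v $ 4"
    using boundaryR(1) arg_cong [OF R [of x], of "\<lambda>X. X $ 1"] unfolding Xl
    by (cases "x = ?a") (auto simp: mat_vec_mult_4)
  show "x \<in> {?a..?l} \<Longrightarrow> dx B \<Psi> x = ?E (x - ?l) $ 4 $ 2 * v $ 3 + ?E (x - ?l) $ 4 $ 3 * v $ 4"
    using boundaryR(4) arg_cong [OF R [of x], of "\<lambda>X. X $ 4"] unfolding Xl
    by (cases "x = ?a") (auto simp: mat_vec_mult_4)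

  have eqs: "(?E ?a *v ?X 0) $ i = (?E (?a - ?l) *v ?X ?l) $ i" if "i \<in> {1, 3, 4}" for i
    using that boundaryL boundaryR by auto
  show "M_mat B s *v v = vector [0, 0, 0, U]"
    unfolding vec_eq_iff forall_4
  proof (intro conjI)
    show "(M_mat B s *v v) $ 1 = (vector [0, 0, 0, U] :: complex^4) $ 1" "(M_mat B s *v v) $ 2 = (vector [0, 0, 0, U] :: complex^4) $ 2"
      "(M_mat B s *v v) $ 3 = (vector [0, 0, 0, U] :: complex^4) $ 3"
      using eqs [of 1] eqs [of 3] eqs [of 4] unfolding X0 Xl
      by (simp_all add: mat_vec_mult_4 M_mat_def Let_def algebra_simps)
    show "(M_mat B s *v v) $ 4 = (vector [0, 0, 0, U] :: complex^4) $ 4"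
      using jump unfolding boundaryL(1) boundaryL(2) boundaryR(2) X0 Xl
      by (simp add: mat_vec_mult_4 M_mat_def Let_def algebra_simps)
  qed
qed

section \<open>Solvability of the transformed system\<close>

lemma invertible_mult_matrix_inv:
  fixes M :: "'a::semiring_1^'n^'m"
  assumes "invertible M"
  shows "M ** matrix_inv M = mat 1" "matrix_inv M ** M = mat 1"
proof -
  have "M ** matrix_inv M = mat 1 \<and> matrix_inv M ** M = mat 1"
    using assms unfolding invertible_def matrix_inv_def by (rule someI_ex)
  then show "M ** matrix_inv M = mat 1" "matrix_inv M ** M = mat 1" by auto
qed

text \<open>The converse of the previous computation: choose the boundary states as the solution of the linear
interface equations, propagate them from the two ends, and glue.\<close>

lemma transformed_system_exists:
  assumes B: "beam_params B" and M: "det (M_mat B s) \<noteq> 0"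
  shows "\<exists>W \<Psi>. transformed_system B s U W \<Psi>"
proof -
  let ?l = "len B" and ?a = "pos B" and ?M = "M_mat B s" and ?A = "A_mat B s"
  have l: "0 < ?a" "?a < ?l" "0 < ?l" and pos: "shear B \<noteq> 0" "bend B \<noteq> 0"
    using B by (auto simp: beam_params_def)
  define v where "v = matrix_inv ?M *v vector [0, 0, 0, U]"
  have "?M ** matrix_inv ?M = mat 1"
    using M invertible_mult_matrix_inv [of ?M] by (simp add: invertible_det_nz)
  then have Mv: "?M *v v = vector [0, 0, 0, U]"
    by (simp add: v_def matrix_vector_mul_assoc)
  define XL where "XL = (\<lambda>x. mat_exp ((x - 0) *\<^sub>R ?A) *v vector [0, v $ 1, v $ 2, 0])"
  define XR where "XR = (\<lambda>x. mat_exp ((x - ?l) *\<^sub>R ?A) *v vector [0, v $ 3, v $ 4, 0])"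
  have dL: "((\<lambda>y. XL y $ i) has_vector_derivative (?A *v XL x) $ i) (at x within T)" for x i T
    using mat_exp_solves_linear_ode [of ?A UNIV 0] has_vector_derivative_at_within
    unfolding solves_linear_ode_def XL_def by blast
  have dR: "((\<lambda>y. XR y $ i) has_vector_derivative (?A *v XR x) $ i) (at x within T)" for x i T
    using mat_exp_solves_linear_ode [of ?A UNIV ?l] has_vector_derivative_at_within
    unfolding solves_linear_ode_def XR_def by blast
  have ends: "XL 0 = vector [0, v $ 1, v $ 2, 0]" "XR ?l = vector [0, v $ 3, v $ 4, 0]"
    unfolding XL_def XR_def by (simp_all only: diff_self mat_exp_0 matrix_vector_mul_lid)
  have rows: "(?M *v v) $ 1 = 0" "(?M *v v) $ 2 = 0" "(?M *v v) $ 3 = 0" "(?M *v v) $ 4 = U"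
    by (simp_all add: Mv)
  have match: "XL ?a $ i = XR ?a $ i" if "i \<in> {1, 3, 4}" for i
    using that rows unfolding XL_def XR_def
    by (auto simp: mat_vec_mult_4 M_mat_def Let_def E_mat_def algebra_simps add_eq_0_iff)
  have jump: "of_real (shear B) * (XL ?a $ 2 - XR ?a $ 2)
      + (of_real (mass B) * s\<^sup>2 + of_real (spring B) + of_real (damp B) * s) * XL ?a $ 1 = U"
    unfolding rows(4) [symmetric] XL_def XR_def
    by (simp add: mat_vec_mult_4 M_mat_def Let_def E_mat_def algebra_simps)

  \<comment> \<open>Components 1, 3 and 4 of the two branches agree at the position of the force.  Component 2, which
    represents the derivative of \<open>W\<close>, jumps there, so its value from the left branch is a
    convention; the transformed system refers to this point only through one-sided limits of \<open>W'\<close>.\<close>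
  define Y where "Y = (\<lambda>i x. if x \<le> ?a then XL x $ i else XR x $ i)"
  have near: "(Y i has_vector_derivative (if x \<le> ?a then ?A *v XL x else ?A *v XR x) $ i)
      (at x within T)" if "x \<noteq> ?a" "x \<in> T" for i x T
  proof (cases "x < ?a")
    case True
    have "(Y i has_vector_derivative (?A *v XL x) $ i) (at x within T)"
      by (rule has_vector_derivative_transform_within [OF dL, where d = "?a - x"])
        (use True that in \<open>auto simp: Y_def dist_real_def\<close>)
    then show ?thesis using True by simp
  next
    case False
    have "(Y i has_vector_derivative (?A *v XR x) $ i) (at x within T)"
      by (rule has_vector_derivative_transform_within [OF dR, where d = "x - ?a"])
        (use False that in \<open>auto simp: Y_def dist_real_def\<close>)
    then show ?thesis using False that by simp
  qed
  have union: "{0..?l} = {0..?a} \<union> {?a..?l}" using l by auto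
  \<comment> \<open>The third component, \<open>\<Psi>\<close>, is differentiable even at the position of the force, since its
    derivative is the fourth component, which is continuous.\<close>
  have at_pos: "(Y i has_vector_derivative (?A *v XL ?a) $ i) (at ?a within {0..?l})"
    if "i \<in> {1, 3, 4}" "(?A *v XL ?a) $ i = (?A *v XR ?a) $ i" for i
    unfolding union
  proof (rule has_vector_derivative_Un)
    show "(Y i has_vector_derivative (?A *v XL ?a) $ i) (at ?a within {0..?a})"
      using has_vector_derivative_transform_within [OF dL [of i ?a "{0..?a}"], of 1 "Y i"] l
      by (auto simp: Y_def)
    show "(Y i has_vector_derivative (?A *v XL ?a) $ i) (at ?a within {?a..?l})"
      unfolding that(2)
    proof (rule has_vector_derivative_transform_within [OF dR, where d = 1])
      fix x assume "x \<in> {?a..?l}"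
      then show "XR x $ i = Y i x"
        using match [OF that(1)] by (cases "x = ?a") (auto simp: Y_def)
    qed (use l in auto)
  qed
  have Y': "(Y i has_vector_derivative Y j x) (at x within {0..?l})"
    if "x \<in> {0..?l} - {?a}" "(i, j) \<in> {(1, 2), (3, 4)}" for i j x
    using near [of x "{0..?l}" i] that by (auto simp: Y_def A_mat_mult split: if_splits)
  have "(Y 3 has_vector_derivative Y 4 x) (at x within {0..?l})" if "x \<in> {0..?l}" for x
    using that Y' [of x 3 4] at_pos [of 3] match [of 4] by (cases "x = ?a") (auto simp: A_mat_mult Y_def)
  then have dx3: "dx B (Y 3) x = Y 4 x" if "x \<in> {0..?l}" for x
    using dx_eqI [OF l(3)] that by blast
  have dx1: "dx B (Y 1) x = Y 2 x" if "x \<in> {0..?l} - {?a}" for x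
    using dx_eqI [OF l(3)] that Y' [of x 1 2] by auto
  have dxdx: "(dx B (Y i) has_vector_derivative (if x \<le> ?a then ?A *v XL x else ?A *v XR x) $ j)
      (at x within {0..?l})"
    if "x \<in> {0..?l} - {?a}" "(i, j) \<in> {(1, 2), (3, 4)}" for i j x
    by (rule has_vector_derivative_transform_within [OF near, where d = "\<bar>x - ?a\<bar>"])
      (use that dx1 dx3 in \<open>auto simp: dist_real_def\<close>)
  have dxdx1: "dx B (dx B (Y 1)) x = of_real (rho B) * s\<^sup>2 / of_real (shear B) * Y 1 x + Y 4 x"
    and dxdx3: "dx B (dx B (Y 3)) x = - of_real (shear B) / of_real (bend B) * Y 2 x
       + (of_real (Irho B) * s\<^sup>2 / of_real (bend B) + of_real (shear B) / of_real (bend B)) * Y 3 x"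
    if "x \<in> {0..?l} - {?a}" for x
    using dx_eqI [OF l(3) _ dxdx [OF that, of 1 2]] dx_eqI [OF l(3) _ dxdx [OF that, of 3 4]] that
    by (auto simp: Y_def A_mat_mult)
  have contL: "isCont (\<lambda>x. XL x $ i) x" and contR: "isCont (\<lambda>x. XR x $ i) x" for i x
    using dL [of i x UNIV] dR [of i x UNIV] has_vector_derivative_continuous by auto
  have limL: "(Y i \<longlongrightarrow> XL ?a $ i) (at_left ?a)" for i
  proof (rule Lim_transform_eventually)
    show "((\<lambda>x. XL x $ i) \<longlongrightarrow> XL ?a $ i) (at_left ?a)"
      using contL continuous_at_imp_continuous_at_within continuous_within by blast
    show "\<forall>\<^sub>F x in at_left ?a. XL x $ i = Y i x"
      by (auto simp: Y_def eventually_at_filter)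
  qed
  have limR: "(Y i \<longlongrightarrow> XR ?a $ i) (at_right ?a)" for i
  proof (rule Lim_transform_eventually)
    show "((\<lambda>x. XR x $ i) \<longlongrightarrow> XR ?a $ i) (at_right ?a)"
      using contR continuous_at_imp_continuous_at_within continuous_within by blast
    show "\<forall>\<^sub>F x in at_right ?a. XR x $ i = Y i x"
      by (auto simp: Y_def eventually_at_filter)
  qed
  have contY: "isCont (Y i) ?a" if "i \<in> {1, 3, 4}" for i
    unfolding isCont_def filterlim_split_at_real
    using limL [of i] limR [of i] match [OF that] by (auto simp: Y_def filterlim_split_at)
  have nhd: "\<forall>\<^sub>F x in nhds ?a. x \<in> {0<..<?l}"
    using l by (intro eventually_nhds_in_open) auto
  have "\<forall>\<^sub>F x in at ?a. dx B (Y 1) x = Y 2 x"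
    unfolding eventually_at_filter by (rule eventually_mono [OF nhd]) (use dx1 in auto)
  then have dx_lim: "(dx B (Y 1) \<longlongrightarrow> c) F \<longleftrightarrow> (Y 2 \<longlongrightarrow> c) F" if "F \<le> at ?a" for c F
    using that by (intro filterlim_cong refl) (rule filter_leD)
  have "transformed_system B s U (Y 1) (Y 3)"
    unfolding transformed_system_def
  proof (intro conjI ballI)
    show "twice_diff_off_pos B (Y 1)" "twice_diff_off_pos B (Y 3)"
      unfolding twice_diff_off_pos_def
      by (intro ballI conjI; (erule differentiableI_vector [OF Y'] differentiableI_vector [OF dxdx]); simp)+
    show "of_real (shear B) * (dx B (dx B (Y 1)) x - dx B (Y 3) x) - of_real (rho B) * s\<^sup>2 * Y 1 x = 0"
      if "x \<in> {0..?l} - {?a}" for x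
      using dxdx1 [OF that] dx3 [of x] that pos by (simp add: field_simps)
    show "of_real (bend B) * dx B (dx B (Y 3)) x + of_real (shear B) * (dx B (Y 1) x - Y 3 x)
          - of_real (Irho B) * s\<^sup>2 * Y 3 x = 0" if "x \<in> {0..?l} - {?a}" for x
      unfolding dxdx3 [OF that] dx1 [OF that] using pos by (simp add: field_simps)
    show "Y 1 0 = 0" "Y 1 ?l = 0" using ends l by (simp_all add: Y_def)
    show "dx B (Y 3) 0 = 0" "dx B (Y 3) ?l = 0" using ends l dx3 by (simp_all add: Y_def)
    show "isCont (Y 1) ?a" "isCont (Y 3) ?a" using contY by auto
    have "isCont (dx B (Y 3)) ?a \<longleftrightarrow> isCont (Y 4) ?a"
      by (rule isCont_cong, rule eventually_mono [OF nhd]) (use dx3 in auto)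
    then show "isCont (dx B (Y 3)) ?a" using contY by auto
    show "\<exists>p q. (dx B (Y 1) \<longlongrightarrow> p) (at_left ?a) \<and> (dx B (Y 1) \<longlongrightarrow> q) (at_right ?a) \<and>
        of_real (shear B) * (p - q)
          + (of_real (mass B) * s\<^sup>2 + of_real (spring B) + of_real (damp B) * s) * Y 1 ?a = U"
    proof (intro exI conjI)
      show "(dx B (Y 1) \<longlongrightarrow> XL ?a $ 2) (at_left ?a)" "(dx B (Y 1) \<longlongrightarrow> XR ?a $ 2) (at_right ?a)"
        using limL [of 2] limR [of 2] by (simp_all add: dx_lim at_le)
      have "Y 1 ?a = XL ?a $ 1" by (simp add: Y_def)
      then show "of_real (shear B) * (XL ?a $ 2 - XR ?a $ 2)
          + (of_real (mass B) * s\<^sup>2 + of_real (spring B) + of_real (damp B) * s) * Y 1 ?a = U"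
        using jump by (simp only:)
    qed
  qed
  then show ?thesis by blast
qed

section \<open>Laplace integrals of exponentially bounded functions\<close>

text \<open>Convergence of the Laplace integral is expressed below as \<open>has_laplace f s (laplace s f)\<close>, because
the integral of a non-integrable function defaults to zero.\<close>

definition laplace :: "complex \<Rightarrow> (real \<Rightarrow> real) \<Rightarrow> complex" where
  "laplace s f = integral {0..} (\<lambda>t. complex_of_real (f t) * exp (- s * complex_of_real t))"

lemma has_laplace_iff_integrable:
  "has_laplace f s (laplace s f) \<longleftrightarrow>
     (\<lambda>t. complex_of_real (f t) * exp (- s * complex_of_real t)) integrable_on {0..}"
  by (simp add: has_laplace_def laplace_def has_integral_iff)

lemma laplace_unique: "has_laplace f s F \<Longrightarrow> laplace s f = F"
  by (simp add: has_laplace_def laplace_def integral_unique)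

lemma has_laplace_cong:
  assumes "\<And>t. t \<ge> 0 \<Longrightarrow> f t = g t" "has_laplace f s F"
  shows "has_laplace g s F"
  using assms(2) unfolding has_laplace_def
  by (rule has_integral_eq [rotated]) (simp add: assms(1))

lemma has_laplace_add: "has_laplace f s F \<Longrightarrow> has_laplace g s G \<Longrightarrow> has_laplace (\<lambda>t. f t + g t) s (F + G)"
  unfolding has_laplace_def by (drule (1) has_integral_add) (simp add: algebra_simps)

lemma has_laplace_cmult: "has_laplace f s F \<Longrightarrow> has_laplace (\<lambda>t. c * f t) s (of_real c * F)"
  unfolding has_laplace_def by (drule has_integral_mult_right [where c = "of_real c"]) (simp add: algebra_simps)

lemma has_laplace_diff: "has_laplace f s F \<Longrightarrow> has_laplace g s G \<Longrightarrow> has_laplace (\<lambda>t. f t - g t) s (F - G)"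
  unfolding has_laplace_def by (drule (1) has_integral_diff) (simp add: algebra_simps)

lemma norm_laplace_kernel_le:
  assumes "\<bar>f t\<bar> \<le> C * exp (\<sigma> * t)"
  shows "norm (complex_of_real (f t) * exp (- s * complex_of_real t)) \<le> C * exp (- (Re s - \<sigma>) * t)"
proof -
  have "norm (complex_of_real (f t) * exp (- s * complex_of_real t)) = \<bar>f t\<bar> * exp (- Re s * t)"
    by (simp add: norm_mult)
  also have "\<dots> \<le> (C * exp (\<sigma> * t)) * exp (- Re s * t)"
    by (intro mult_right_mono assms) auto
  finally show ?thesis
    by (simp add: mult.assoc exp_add [symmetric] algebra_simps)
qed

text \<open>The gauge integral yields the integrability of a dominated pointwise limit of sequences along with
its value.  In this way the one-sided limits of \<open>w'\<close> at the position of the force, which are given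
only pointwise in time, turn out to be transformable.\<close>

lemma laplace_dominated_convergence_sequence:
  fixes f :: "nat \<Rightarrow> real \<Rightarrow> real"
  assumes "\<sigma> < Re s"
    and "\<And>k. has_laplace (f k) s (laplace s (f k))"
    and "\<And>k t. t \<ge> 0 \<Longrightarrow> \<bar>f k t\<bar> \<le> C * exp (\<sigma> * t)"
    and "\<And>t. t \<ge> 0 \<Longrightarrow> (\<lambda>k. f k t) \<longlonglongrightarrow> g t"
  shows "has_laplace g s (laplace s g)" and "(\<lambda>k. laplace s (f k)) \<longlonglongrightarrow> laplace s g"
proof -
  let ?K = "\<lambda>f t. complex_of_real (f t) * exp (- s * complex_of_real t)"
  let ?h = "\<lambda>t. C * exp (- (Re s - \<sigma>) * t)"
  have h: "?h integrable_on {0..}"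
    using assms(1) by (intro integrable_on_mult_right integrable_on_exp_minus_to_infinity) auto
  have int: "?K (f k) integrable_on {0..}" for k
    using assms(2) by (simp add: has_laplace_iff_integrable)
  have le: "norm (?K (f k) t) \<le> ?h t" if "t \<in> {0..}" for k t
    using assms(3) [of t k] that by (intro norm_laplace_kernel_le) auto
  have lim: "(\<lambda>k. ?K (f k) t) \<longlonglongrightarrow> ?K g t" if "t \<in> {0..}" for t
    using that by (intro tendsto_mult_right tendsto_of_real assms(4)) auto
  show "has_laplace g s (laplace s g)"
    unfolding has_laplace_iff_integrable by (rule dominated_convergence(1) [OF int h le lim])
  show "(\<lambda>k. laplace s (f k)) \<longlonglongrightarrow> laplace s g"
    unfolding laplace_def by (rule dominated_convergence(2) [OF int h le lim])
qed

lemma laplace_dominated_convergence: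
  fixes f :: "real \<Rightarrow> real \<Rightarrow> real"
  assumes "\<sigma> < Re s" and nontriv: "at x within T \<noteq> bot"
    and "\<And>y. y \<in> T - {x} \<Longrightarrow> has_laplace (f y) s (laplace s (f y))"
    and "\<And>y t. y \<in> T - {x} \<Longrightarrow> t \<ge> 0 \<Longrightarrow> \<bar>f y t\<bar> \<le> C * exp (\<sigma> * t)"
    and lim: "\<And>t. t \<ge> 0 \<Longrightarrow> ((\<lambda>y. f y t) \<longlongrightarrow> g t) (at x within T)"
  shows "has_laplace g s (laplace s g)" and "((\<lambda>y. laplace s (f y)) \<longlongrightarrow> laplace s g) (at x within T)"
proof -
  have seq: "has_laplace g s (laplace s g)" "(\<lambda>k. laplace s (f (X k))) \<longlonglongrightarrow> laplace s g"
    if "\<forall>i. X i \<in> T - {x}" "X \<longlonglongrightarrow> x" for X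
  proof -
    have "(\<lambda>k. f (X k) t) \<longlonglongrightarrow> g t" if "t \<ge> 0" for t
      using lim [OF that] \<open>\<forall>i. X i \<in> T - {x}\<close> \<open>X \<longlonglongrightarrow> x\<close>
      by (simp add: tendsto_at_iff_sequentially o_def)
    note * = laplace_dominated_convergence_sequence [OF assms(1), of "\<lambda>k. f (X k)" C g, OF _ _ this]
    show "has_laplace g s (laplace s g)" "(\<lambda>k. laplace s (f (X k))) \<longlonglongrightarrow> laplace s g"
      by (rule *; use assms(3,4) that(1) in blast)+
  qed
  obtain X :: "nat \<Rightarrow> real" where "\<forall>i. X i \<in> T - {x}" "X \<longlonglongrightarrow> x"
    using nontriv by (auto simp: trivial_limit_within islimpt_sequential)
  then show "has_laplace g s (laplace s g)" by (rule seq)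
  show "((\<lambda>y. laplace s (f y)) \<longlongrightarrow> laplace s g) (at x within T)"
    unfolding tendsto_at_iff_sequentially using seq(2) by (simp add: o_def)
qed

text \<open>The truncations of \<open>f\<close> to \<open>[0, n]\<close> are transformable by continuity and converge dominatedly to
\<open>f\<close>.  The second part is the description of the Laplace integral as an improper integral, which
integration by parts needs.\<close>

lemma has_laplace_continuous:
  assumes "\<sigma> < Re s" and cont: "continuous_on {0..} f"
    and bound: "\<And>t. t \<ge> 0 \<Longrightarrow> \<bar>f t\<bar> \<le> C * exp (\<sigma> * t)"
  shows "has_laplace f s (laplace s f)"
    and "(\<lambda>n. integral {0..real n} (\<lambda>t. complex_of_real (f t) * exp (- s * complex_of_real t)))
           \<longlonglongrightarrow> laplace s f"
proof -
  let ?K = "\<lambda>t. complex_of_real (f t) * exp (- s * complex_of_real t)"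
  let ?f = "\<lambda>n t. if t \<in> {0..real n} then f t else 0"
  have "?K integrable_on {0..real n}" for n
    by (intro integrable_continuous_interval continuous_intros continuous_on_subset [OF cont]) auto
  then have "(?K has_integral integral {0..real n} ?K) {0..real n}" for n
    by (simp add: integrable_integral)
  then have "((\<lambda>t. if t \<in> {0..real n} then ?K t else 0) has_integral integral {0..real n} ?K) {0..}" for n
    by (subst has_integral_restrict) auto
  then have f: "has_laplace (?f n) s (integral {0..real n} ?K)" for n
    unfolding has_laplace_def by (rule has_integral_eq [rotated]) auto
  have C: "0 \<le> C * exp (\<sigma> * t)" if "t \<ge> 0" for t
    using bound [OF that] by linarith
  have lim: "(\<lambda>n. ?f n t) \<longlonglongrightarrow> f t" if "t \<ge> 0" for t
  proof (rule tendsto_eventually)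
    obtain N where "t \<le> real N" using real_arch_simple by blast
    then show "\<forall>\<^sub>F n in sequentially. ?f n t = f t"
      using that by (auto simp: eventually_sequentially intro!: exI [of _ N])
  qed
  have l: "laplace s (?f n) = integral {0..real n} ?K" for n
    by (rule laplace_unique [OF f])
  have f': "has_laplace (?f n) s (laplace s (?f n))" for n
    using f [of n] by (simp only: l)
  have b: "\<bar>?f n t\<bar> \<le> C * exp (\<sigma> * t)" if "t \<ge> 0" for n t
    using bound [OF that] C [OF that] by auto
  show "has_laplace f s (laplace s f)"
    by (rule laplace_dominated_convergence_sequence(1) [OF assms(1) f' b lim])
  have "(\<lambda>n. laplace s (?f n)) \<longlonglongrightarrow> laplace s f"
    by (rule laplace_dominated_convergence_sequence(2) [OF assms(1) f' b lim])
  then show "(\<lambda>n. integral {0..real n} ?K) \<longlonglongrightarrow> laplace s f"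
    by (simp only: l)
qed

text \<open>Integration by parts: the fundamental theorem of calculus for \<open>f(t) exp (- s t)\<close> on \<open>[0, n]\<close>, where
the contribution of the upper end vanishes in the limit because of the growth bound.\<close>

lemma laplace_derivative:
  assumes "\<sigma> < Re s"
    and deriv: "\<And>t. t \<ge> 0 \<Longrightarrow> (f has_vector_derivative f' t) (at t within {0..})"
    and cont': "continuous_on {0..} f'"
    and bound: "\<And>t. t \<ge> 0 \<Longrightarrow> \<bar>f t\<bar> \<le> C * exp (\<sigma> * t)" "\<And>t. t \<ge> 0 \<Longrightarrow> \<bar>f' t\<bar> \<le> C * exp (\<sigma> * t)"
  shows "laplace s f' = s * laplace s f - of_real (f 0)"
proof -
  let ?K = "\<lambda>f t. complex_of_real (f t) * exp (- s * complex_of_real t)"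
  have cont: "continuous_on {0..} f"
    using deriv by (intro continuous_on_vector_derivative) auto
  have FTC: "((\<lambda>t. ?K f' t - s * ?K f t) has_integral ?K f (real n) - ?K f 0) {0..real n}" for n
  proof (rule fundamental_theorem_of_calculus)
    fix t assume t: "t \<in> {0..real n}"
    have "((\<lambda>t. complex_of_real (f t)) has_vector_derivative complex_of_real (f' t)) (at t within {0..real n})"
      using deriv [of t] t
      by (intro has_vector_derivative_of_real)
        (auto simp: has_real_derivative_iff_has_vector_derivative intro: has_vector_derivative_within_subset)
    moreover have "((\<lambda>t. exp (- s * complex_of_real t)) has_vector_derivative - s * exp (- s * complex_of_real t))
        (at t within {0..real n})"
      by (rule has_vector_derivative_real_field [of "\<lambda>z. exp (- s * z)"])
        (auto intro!: derivative_eq_intros)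
    ultimately show "(?K f has_vector_derivative ?K f' t - s * ?K f t) (at t within {0..real n})"
      by (auto dest: has_vector_derivative_mult simp: algebra_simps)
  qed simp
  have int: "?K g integrable_on {0..real n}" if "continuous_on {0..} g" for g n
    by (intro integrable_continuous_interval continuous_intros continuous_on_subset [OF that]) auto
  have eq: "integral {0..real n} (?K f') - s * integral {0..real n} (?K f) = ?K f (real n) - ?K f 0" for n
    using integral_unique [OF FTC [of n]]
      integral_diff [OF int [OF cont', of n] integrable_on_mult_right [OF int [OF cont, of n]], of s]
    by simp
  have "(\<lambda>n. ?K f (real n) - ?K f 0) \<longlonglongrightarrow> laplace s f' - s * laplace s f"
    using tendsto_diff [OF has_laplace_continuous(2) [OF assms(1) cont' bound(2)]
        tendsto_mult_left [OF has_laplace_continuous(2) [OF assms(1) cont bound(1)], of s]]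
    by (simp only: eq)
  moreover have "(\<lambda>n. ?K f (real n)) \<longlonglongrightarrow> 0"
  proof (rule Lim_null_comparison)
    show "\<forall>\<^sub>F n in sequentially. norm (?K f (real n)) \<le> C * exp (- (Re s - \<sigma>) * real n)"
      by (intro always_eventually allI norm_laplace_kernel_le bound(1)) auto
    have "(\<lambda>n. C * exp (- (Re s - \<sigma>)) ^ n) \<longlonglongrightarrow> C * 0"
      using assms(1) by (intro tendsto_mult_left LIMSEQ_power_zero) auto
    then show "(\<lambda>n. C * exp (- (Re s - \<sigma>) * real n)) \<longlonglongrightarrow> 0"
      by (simp add: exp_of_nat_mult [symmetric] mult.commute)
  qed
  then have "(\<lambda>n. ?K f (real n) - ?K f 0) \<longlonglongrightarrow> 0 - ?K f 0"
    by (intro tendsto_diff tendsto_const)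
  ultimately have "laplace s f' - s * laplace s f = 0 - ?K f 0"
    by (rule LIMSEQ_unique)
  then show ?thesis by (simp add: algebra_simps)
qed

text \<open>Differentiation under the Laplace integral.  By the mean value theorem on the convex set \<open>T\<close>, the
bound on the derivatives is also a bound on the difference quotients, so dominated convergence
applies to them.\<close>

lemma laplace_has_vector_derivative:
  fixes f g :: "real \<Rightarrow> real \<Rightarrow> real"
  assumes "\<sigma> < Re s" and T: "convex T" "x \<in> T" and nontriv: "at x within T \<noteq> bot"
    and f: "\<And>y. y \<in> T \<Longrightarrow> has_laplace (f y) s (laplace s (f y))"
    and deriv: "\<And>y t. y \<in> T \<Longrightarrow> t \<ge> 0 \<Longrightarrow> ((\<lambda>\<xi>. f \<xi> t) has_vector_derivative g y t) (at y within T)"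
    and bound: "\<And>y t. y \<in> T \<Longrightarrow> t \<ge> 0 \<Longrightarrow> \<bar>g y t\<bar> \<le> C * exp (\<sigma> * t)"
  shows "has_laplace (g x) s (laplace s (g x))"
    and "((\<lambda>\<xi>. laplace s (f \<xi>)) has_vector_derivative laplace s (g x)) (at x within T)"
proof -
  let ?q = "\<lambda>y t. inverse (y - x) * (f y t - f x t)"
  have q: "has_laplace (?q y) s (of_real (inverse (y - x)) * (laplace s (f y) - laplace s (f x)))" if "y \<in> T - {x}" for y
    using that T by (intro has_laplace_cmult has_laplace_diff f) auto
  have lq: "laplace s (?q y) = of_real (inverse (y - x)) * (laplace s (f y) - laplace s (f x))" if "y \<in> T - {x}" for y
    by (rule laplace_unique [OF q [OF that]])
  have q': "has_laplace (?q y) s (laplace s (?q y))" if "y \<in> T - {x}" for y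
    using q [OF that] by (simp only: lq [OF that])
  have bq: "\<bar>?q y t\<bar> \<le> C * exp (\<sigma> * t)" if y: "y \<in> T - {x}" and t: "t \<ge> 0" for y t
  proof -
    have "norm (f y t - f x t) \<le> C * exp (\<sigma> * t) * norm (y - x)"
      using T y t deriv bound
      by (intro field_differentiable_bound [of T "\<lambda>\<xi>. f \<xi> t" "\<lambda>\<xi>. g \<xi> t"])
        (auto simp: has_real_derivative_iff_has_vector_derivative)
    then show ?thesis using y by (simp add: abs_mult field_simps)
  qed
  have lim: "((\<lambda>y. ?q y t) \<longlongrightarrow> g x t) (at x within T)" if "t \<ge> 0" for t
    using deriv [OF T(2) that] by (simp add: has_vector_derivative_iff_quotient)
  show "has_laplace (g x) s (laplace s (g x))"
    by (rule laplace_dominated_convergence(1) [OF assms(1) nontriv q' bq lim])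
  have "((\<lambda>y. laplace s (?q y)) \<longlongrightarrow> laplace s (g x)) (at x within T)"
    by (rule laplace_dominated_convergence(2) [OF assms(1) nontriv q' bq lim])
  then show "((\<lambda>\<xi>. laplace s (f \<xi>)) has_vector_derivative laplace s (g x)) (at x within T)"
    unfolding has_vector_derivative_iff_quotient
  proof (rule Lim_transform_within [of _ _ _ _ 1])
    fix y assume "y \<in> T" "0 < dist y x"
    then show "laplace s (?q y) = inverse (y - x) *\<^sub>R (laplace s (f y) - laplace s (f x))"
      using lq [of y] by (simp add: scaleR_conv_of_real)
  qed simp
qed

section \<open>The Laplace transform of a trajectory\<close>

text \<open>l'Hopital's rule, applied to the difference quotient at \<open>c\<close>.\<close>

lemma has_derivative_from_limit:
  fixes f f' :: "real \<Rightarrow> real"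
  assumes c: "a < c" "c < b" and cont: "continuous_on {a..b} f"
    and deriv: "\<And>x. x \<in> {a..b} - {c} \<Longrightarrow> (f has_vector_derivative f' x) (at x within {a..b})"
    and lim: "(f' \<longlongrightarrow> r) (at c)"
  shows "(f has_vector_derivative r) (at c)"
proof -
  have ev: "\<forall>\<^sub>F x in at c. x \<in> {a<..<b} - {c}"
    using c eventually_nhds_in_open [of "{a<..<b}" c] by (auto simp: eventually_at_filter elim: eventually_mono)
  have "((\<lambda>x. (f x - f c) / (x - c)) \<longlongrightarrow> r) (at c)"
  proof (rule lhopital)
    have "isCont f c"
      using cont c by (simp add: continuous_on_interior)
    then show "((\<lambda>x. f x - f c) \<longlongrightarrow> 0) (at c)"
      by (simp add: isCont_def LIM_zero)
    show "((\<lambda>x. x - c) \<longlongrightarrow> 0) (at c)"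
      by (intro LIM_zero tendsto_ident_at)
    show "\<forall>\<^sub>F x in at c. x - c \<noteq> 0" by (simp add: eventually_at_filter)
    show "\<forall>\<^sub>F x in at c. (1::real) \<noteq> 0" by simp
    show "\<forall>\<^sub>F x in at c. ((\<lambda>x. f x - f c) has_real_derivative f' x) (at x)"
      using ev
    proof (rule eventually_mono)
      fix x assume x: "x \<in> {a<..<b} - {c}"
      then have "(f has_real_derivative f' x) (at x)"
        using deriv [of x] by (simp add: has_real_derivative_iff_has_vector_derivative at_within_Icc_at)
      then show "((\<lambda>x. f x - f c) has_real_derivative f' x) (at x)"
        by (auto intro!: derivative_eq_intros)
    qed
    show "\<forall>\<^sub>F x in at c. ((\<lambda>x. x - c) has_real_derivative 1) (at x)"
      by (auto intro!: derivative_eq_intros always_eventually)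
    show "((\<lambda>x. f' x / 1) \<longlongrightarrow> r) (at c)" using lim by simp
  qed
  then show ?thesis
    by (simp add: has_field_derivative_iff has_real_derivative_iff_has_vector_derivative [symmetric])
qed

lemma C2_in_time_derivatives:
  assumes "C2_in_time f"
  shows "t \<ge> 0 \<Longrightarrow> (f has_vector_derivative dt f t) (at t within {0..})"
    and "t \<ge> 0 \<Longrightarrow> (dt f has_vector_derivative dt (dt f) t) (at t within {0..})"
    and "continuous_on {0..} f" and "continuous_on {0..} (dt f)" and "continuous_on {0..} (dt (dt f))"
proof -
  show 1: "(f has_vector_derivative dt f t) (at t within {0..})" if "t \<ge> 0" for t
    using assms that vector_derivative_works unfolding C2_in_time_def dt_def by blast
  show 2: "(dt f has_vector_derivative dt (dt f) t) (at t within {0..})" if "t \<ge> 0" for t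
    using assms that vector_derivative_works unfolding C2_in_time_def dt_def [of "dt f"] by blast
  show "continuous_on {0..} f" "continuous_on {0..} (dt f)"
    using 1 2 by (auto intro!: continuous_on_vector_derivative)
  show "continuous_on {0..} (dt (dt f))" using assms by (simp add: C2_in_time_def)
qed

text \<open>Under zero initial conditions each time derivative becomes a factor \<open>s\<close>.\<close>

lemma laplace_time_derivatives:
  assumes "\<sigma> < Re s" and f: "C2_in_time f" and init: "f 0 = 0" "dt f 0 = 0"
    and bound: "\<And>t. t \<ge> 0 \<Longrightarrow> \<bar>f t\<bar> \<le> C * exp (\<sigma> * t)" "\<And>t. t \<ge> 0 \<Longrightarrow> \<bar>dt f t\<bar> \<le> C * exp (\<sigma> * t)"
      "\<And>t. t \<ge> 0 \<Longrightarrow> \<bar>dt (dt f) t\<bar> \<le> C * exp (\<sigma> * t)"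
  shows "has_laplace f s (laplace s f)" "has_laplace (dt f) s (s * laplace s f)"
    "has_laplace (dt (dt f)) s (s\<^sup>2 * laplace s f)"
proof -
  note d = C2_in_time_derivatives [OF f]
  show "has_laplace f s (laplace s f)"
    by (rule has_laplace_continuous(1) [OF assms(1) d(3) bound(1)])
  have 1: "laplace s (dt f) = s * laplace s f"
    using laplace_derivative [OF assms(1) d(1) d(4) bound(1,2)] init by simp
  have 2: "laplace s (dt (dt f)) = s * laplace s (dt f)"
    using laplace_derivative [OF assms(1) d(2) d(5) bound(2,3)] init by simp
  show "has_laplace (dt f) s (s * laplace s f)"
    using has_laplace_continuous(1) [OF assms(1) d(4) bound(2)] by (simp add: 1)
  show "has_laplace (dt (dt f)) s (s\<^sup>2 * laplace s f)"
    using has_laplace_continuous(1) [OF assms(1) d(5) bound(3)] by (simp add: 1 2 power2_eq_square mult.assoc)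
qed

text \<open>Differentiation under the integral needs a convex set without the position of the force, where
\<open>w\<close> may have a kink; a small neighbourhood of \<open>x\<close> has the same derivatives as the
whole interval.\<close>

lemma convex_nhd_avoiding_point:
  assumes "x \<in> {0..l} - {a::real}"
  obtains T where "convex T" "T \<subseteq> {0..l} - {a}" "x \<in> T" "at x within T = at x within {0..l}"
proof
  let ?T = "{0..l} \<inter> ball x \<bar>x - a\<bar>"
  show "convex ?T" by (intro convex_Int) auto
  show "?T \<subseteq> {0..l} - {a}" by (auto simp: dist_real_def)
  show "x \<in> ?T" using assms by auto
  show "at x within ?T = at x within {0..l}"
    using assms by (intro at_within_nhd [of x "ball x \<bar>x - a\<bar>"]) auto
qed

text \<open>A trajectory with a single growth bound for both \<open>w\<close> and \<open>\<psi>\<close>.\<close>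

locale transformable_trajectory =
  fixes B :: beam and F0 :: "real \<Rightarrow> real" and w \<psi> :: "real \<Rightarrow> real \<Rightarrow> real" and s :: complex and C \<sigma> :: real
  assumes params: "beam_params B" and control: "control_system B F0 w \<psi>" and zero: "zero_initial B w \<psi>"
    and rate: "\<sigma> < Re s"
    and growth_t: "\<lbrakk>f = w \<or> f = \<psi>; t \<ge> 0; x \<in> {0..len B}\<rbrakk> \<Longrightarrow>
      \<bar>f x t\<bar> \<le> C * exp (\<sigma> * t) \<and> \<bar>dt (f x) t\<bar> \<le> C * exp (\<sigma> * t) \<and> \<bar>dt (dt (f x)) t\<bar> \<le> C * exp (\<sigma> * t)"
    and growth_x: "\<lbrakk>f = w \<or> f = \<psi>; t \<ge> 0; x \<in> {0..len B} - {pos B}\<rbrakk> \<Longrightarrow>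
      \<bar>dx B (\<lambda>\<xi>. f \<xi> t) x\<bar> \<le> C * exp (\<sigma> * t)"
begin

definition w' where "w' x t = dx B (\<lambda>\<xi>. w \<xi> t) x"
definition \<psi>' where "\<psi>' x t = dx B (\<lambda>\<xi>. \<psi> \<xi> t) x"
definition w'' where "w'' x t = dx B (\<lambda>\<xi>. w' \<xi> t) x"
definition \<psi>'' where "\<psi>'' x t = dx B (\<lambda>\<xi>. \<psi>' \<xi> t) x"

abbreviation W where "W x \<equiv> laplace s (w x)"
abbreviation \<Psi> where "\<Psi> x \<equiv> laplace s (\<psi> x)"

lemma geometry: "0 < len B" "0 < pos B" "pos B < len B"
  and constants: "0 < shear B" "0 < bend B"
  using params by (auto simp: beam_params_def)

lemma system:
  assumes "t \<ge> 0"
  shows "continuous_on {0..len B} (\<lambda>x. w x t)" "continuous_on {0..len B} (\<lambda>x. \<psi> x t)"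
    and "w 0 t = 0" "w (len B) t = 0" "\<psi>' 0 t = 0" "\<psi>' (len B) t = 0"
    and "\<exists>r. ((\<lambda>x. \<psi>' x t) \<longlongrightarrow> r) (at_left (pos B)) \<and> ((\<lambda>x. \<psi>' x t) \<longlongrightarrow> r) (at_right (pos B))"
    and "\<exists>p q. ((\<lambda>x. w' x t) \<longlongrightarrow> p) (at_left (pos B)) \<and> ((\<lambda>x. w' x t) \<longlongrightarrow> q) (at_right (pos B)) \<and>
           F0 t - mass B * dt (dt (w (pos B))) t - spring B * w (pos B) t - damp B * dt (w (pos B)) t
             - shear B * (p - q) = 0"
  using control assms unfolding control_system_def Let_def w'_def \<psi>'_def by blast+

lemma x_derivatives:
  assumes "t \<ge> 0" "x \<in> {0..len B} - {pos B}"
  shows "((\<lambda>\<xi>. w \<xi> t) has_vector_derivative w' x t) (at x within {0..len B})"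
    "((\<lambda>\<xi>. \<psi> \<xi> t) has_vector_derivative \<psi>' x t) (at x within {0..len B})"
    "((\<lambda>\<xi>. w' \<xi> t) has_vector_derivative w'' x t) (at x within {0..len B})"
    "((\<lambda>\<xi>. \<psi>' \<xi> t) has_vector_derivative \<psi>'' x t) (at x within {0..len B})"
proof -
  have "twice_diff_off_pos B (\<lambda>x. w x t)" "twice_diff_off_pos B (\<lambda>x. \<psi> x t)"
    using control assms unfolding control_system_def Let_def by blast+
  then show "((\<lambda>\<xi>. w \<xi> t) has_vector_derivative w' x t) (at x within {0..len B})"
    "((\<lambda>\<xi>. \<psi> \<xi> t) has_vector_derivative \<psi>' x t) (at x within {0..len B})"
    "((\<lambda>\<xi>. w' \<xi> t) has_vector_derivative w'' x t) (at x within {0..len B})"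
    "((\<lambda>\<xi>. \<psi>' \<xi> t) has_vector_derivative \<psi>'' x t) (at x within {0..len B})"
    using assms(2) unfolding twice_diff_off_pos_def w''_def \<psi>''_def w'_def \<psi>'_def
    by (blast intro: has_vector_derivative_dx)+
qed

lemma second_x_derivatives:
  assumes "t \<ge> 0" "x \<in> {0..len B} - {pos B}"
  shows "w'' x t = rho B / shear B * dt (dt (w x)) t + \<psi>' x t"
    "\<psi>'' x t = Irho B / bend B * dt (dt (\<psi> x)) t - shear B / bend B * (w' x t - \<psi> x t)"
proof -
  have "rho B * dt (dt (w x)) t - shear B * (w'' x t - \<psi>' x t) = 0"
    and "Irho B * dt (dt (\<psi> x)) t - bend B * \<psi>'' x t - shear B * (w' x t - \<psi> x t) = 0"
    using control assms unfolding control_system_def Let_def w''_def \<psi>''_def w'_def \<psi>'_def by blast+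
  then show "w'' x t = rho B / shear B * dt (dt (w x)) t + \<psi>' x t"
    "\<psi>'' x t = Irho B / bend B * dt (dt (\<psi> x)) t - shear B / bend B * (w' x t - \<psi> x t)"
    using constants by (simp_all add: field_simps)
qed

text \<open>Only \<open>w\<close> can have a kink at the position of the force: the interface conditions give \<open>\<psi>'\<close> a two-sided
limit there, so \<open>\<psi>\<close> is differentiable at that point as well, and the growth bound passes to the
limit.  This makes the output \<open>\<psi>'\<close> meaningful also when it is measured where the force acts.\<close>

lemma \<psi>_derivative_everywhere:
  assumes "t \<ge> 0" "x \<in> {0..len B}"
  shows "((\<lambda>\<xi>. \<psi> \<xi> t) has_vector_derivative \<psi>' x t) (at x within {0..len B})"
    and "((\<lambda>x. \<psi>' x t) \<longlongrightarrow> \<psi>' (pos B) t) (at (pos B))"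
    and "\<bar>\<psi>' x t\<bar> \<le> C * exp (\<sigma> * t)"
proof -
  obtain r where "((\<lambda>x. \<psi>' x t) \<longlongrightarrow> r) (at_left (pos B))" "((\<lambda>x. \<psi>' x t) \<longlongrightarrow> r) (at_right (pos B))"
    using system(7) [OF assms(1)] by blast
  then have r: "((\<lambda>x. \<psi>' x t) \<longlongrightarrow> r) (at (pos B))"
    by (rule filterlim_split_at)
  have "((\<lambda>\<xi>. \<psi> \<xi> t) has_vector_derivative r) (at (pos B))"
    by (rule has_derivative_from_limit [OF geometry(2,3) system(2) [OF assms(1)] x_derivatives(2) r])
      (use assms in auto)
  then have at_pos: "((\<lambda>\<xi>. \<psi> \<xi> t) has_vector_derivative r) (at (pos B) within {0..len B})"
    by (rule has_vector_derivative_at_within)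
  have r_eq: "\<psi>' (pos B) t = r"
    unfolding \<psi>'_def using geometry by (intro dx_eqI at_pos) auto
  show "((\<lambda>\<xi>. \<psi> \<xi> t) has_vector_derivative \<psi>' x t) (at x within {0..len B})"
    using x_derivatives(2) [OF assms(1), of x] assms(2) at_pos r_eq by (cases "x = pos B") auto
  show "((\<lambda>x. \<psi>' x t) \<longlongrightarrow> \<psi>' (pos B) t) (at (pos B))"
    using r r_eq by simp
  show "\<bar>\<psi>' x t\<bar> \<le> C * exp (\<sigma> * t)"
  proof (cases "x = pos B")
    case True
    have "\<bar>r\<bar> \<le> C * exp (\<sigma> * t)"
    proof (rule tendsto_upperbound [OF tendsto_rabs [OF r]])
      have "\<forall>\<^sub>F x in nhds (pos B). x \<in> {0<..<len B}"
        using geometry by (intro eventually_nhds_in_open) auto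
      then show "\<forall>\<^sub>F x in at (pos B). \<bar>\<psi>' x t\<bar> \<le> C * exp (\<sigma> * t)"
        unfolding eventually_at_filter
        by (rule eventually_mono) (use growth_x [of \<psi> t] assms(1) in \<open>auto simp: \<psi>'_def\<close>)
    qed simp
    then show ?thesis using True r_eq by simp
  next
    case False
    then show ?thesis using growth_x [of \<psi> t x] assms by (simp add: \<psi>'_def)
  qed
qed

lemma time_transforms:
  assumes "x \<in> {0..len B}"
  shows "has_laplace (w x) s (W x)" "has_laplace (dt (w x)) s (s * W x)" "has_laplace (dt (dt (w x))) s (s\<^sup>2 * W x)"
    "has_laplace (\<psi> x) s (\<Psi> x)" "has_laplace (dt (dt (\<psi> x))) s (s\<^sup>2 * \<Psi> x)"
proof -
  have C2: "C2_in_time (w x)" "C2_in_time (\<psi> x)"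
    using control assms by (auto simp: control_system_def)
  have init: "w x 0 = 0" "dt (w x) 0 = 0" "\<psi> x 0 = 0" "dt (\<psi> x) 0 = 0"
    using zero assms by (auto simp: zero_initial_def)
  note gw = growth_t [of w _ x, OF _ _ assms] and g\<psi> = growth_t [of \<psi> _ x, OF _ _ assms]
  show "has_laplace (w x) s (W x)" "has_laplace (dt (w x)) s (s * W x)" "has_laplace (dt (dt (w x))) s (s\<^sup>2 * W x)"
    using laplace_time_derivatives [OF rate C2(1) init(1,2)] gw by blast+
  show "has_laplace (\<psi> x) s (\<Psi> x)" "has_laplace (dt (dt (\<psi> x))) s (s\<^sup>2 * \<Psi> x)"
    using laplace_time_derivatives [OF rate C2(2) init(3,4)] g\<psi> by blast+
qed

lemma nontrivial: "x \<in> {0..len B} \<Longrightarrow> at x within {0..len B} \<noteq> bot"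
  using geometry by (simp add: trivial_limit_within)

lemma laplace_x_derivative:
  assumes "x \<in> {0..len B} - {pos B}"
    and f: "\<And>y. y \<in> {0..len B} - {pos B} \<Longrightarrow> has_laplace (f y) s (laplace s (f y))"
    and deriv: "\<And>y t. y \<in> {0..len B} - {pos B} \<Longrightarrow> t \<ge> 0 \<Longrightarrow>
      ((\<lambda>\<xi>. f \<xi> t) has_vector_derivative g y t) (at y within {0..len B})"
    and bound: "\<And>y t. y \<in> {0..len B} - {pos B} \<Longrightarrow> t \<ge> 0 \<Longrightarrow> \<bar>g y t\<bar> \<le> K * exp (\<sigma> * t)"
  shows "has_laplace (g x) s (laplace s (g x))"
    and "((\<lambda>\<xi>. laplace s (f \<xi>)) has_vector_derivative laplace s (g x)) (at x within {0..len B})"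
proof -
  obtain T where T: "convex T" "T \<subseteq> {0..len B} - {pos B}" "x \<in> T" "at x within T = at x within {0..len B}"
    using convex_nhd_avoiding_point [OF assms(1)] by blast
  have nt: "at x within T \<noteq> bot"
    using nontrivial assms(1) T(4) by auto
  have d: "((\<lambda>\<xi>. f \<xi> t) has_vector_derivative g y t) (at y within T)" if "y \<in> T" "t \<ge> 0" for y t
    using deriv [of y t] that T(2) has_vector_derivative_within_subset [of "\<lambda>\<xi>. f \<xi> t" "g y t" y "{0..len B}" T]
    by blast
  have *: "y \<in> T \<Longrightarrow> has_laplace (f y) s (laplace s (f y))"
    "y \<in> T \<Longrightarrow> t \<ge> 0 \<Longrightarrow> \<bar>g y t\<bar> \<le> K * exp (\<sigma> * t)" for y t
    using f bound T(2) by blast+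
  show "has_laplace (g x) s (laplace s (g x))"
    by (rule laplace_has_vector_derivative(1) [OF rate T(1) T(3) nt *(1) d *(2)])
  show "((\<lambda>\<xi>. laplace s (f \<xi>)) has_vector_derivative laplace s (g x)) (at x within {0..len B})"
    unfolding T(4) [symmetric]
    by (rule laplace_has_vector_derivative(2) [OF rate T(1) T(3) nt *(1) d *(2)])
qed

lemma transform_w':
  assumes "x \<in> {0..len B} - {pos B}"
  shows "has_laplace (w' x) s (laplace s (w' x))"
    and "(W has_vector_derivative laplace s (w' x)) (at x within {0..len B})"
proof -
  have *: "\<bar>w' y t\<bar> \<le> C * exp (\<sigma> * t)" if "y \<in> {0..len B} - {pos B}" "t \<ge> 0" for y t
    using growth_x [of w t y] that by (simp add: w'_def)
  show "has_laplace (w' x) s (laplace s (w' x))"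
    by (rule laplace_x_derivative(1) [OF assms, of w w' C]) (use time_transforms x_derivatives * in auto)
  show "(W has_vector_derivative laplace s (w' x)) (at x within {0..len B})"
    by (rule laplace_x_derivative(2) [OF assms, of w w' C]) (use time_transforms x_derivatives * in auto)
qed

lemma transform_\<psi>':
  assumes "x \<in> {0..len B}"
  shows "has_laplace (\<psi>' x) s (laplace s (\<psi>' x))"
    and "(\<Psi> has_vector_derivative laplace s (\<psi>' x)) (at x within {0..len B})"
  using laplace_has_vector_derivative [OF rate _ assms nontrivial [OF assms], of \<psi> \<psi>' C]
    time_transforms \<psi>_derivative_everywhere(1,3) by auto

text \<open>The growth bounds do not mention second derivatives in \<open>x\<close>; the equations of motion express these
through bounded quantities, which both justifies differentiating once more under the integral and
evaluates the result.\<close>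

lemma second_transforms:
  assumes "x \<in> {0..len B} - {pos B}"
  shows "((\<lambda>\<xi>. laplace s (w' \<xi>)) has_vector_derivative
        of_real (rho B) / of_real (shear B) * s\<^sup>2 * W x + laplace s (\<psi>' x)) (at x within {0..len B})"
    and "((\<lambda>\<xi>. laplace s (\<psi>' \<xi>)) has_vector_derivative
        of_real (Irho B) / of_real (bend B) * s\<^sup>2 * \<Psi> x
          - of_real (shear B) / of_real (bend B) * (laplace s (w' x) - \<Psi> x)) (at x within {0..len B})"
proof -
  have x: "x \<in> {0..len B}" using assms by simp
  let ?k1 = "rho B / shear B" and ?k2 = "Irho B / bend B" and ?k3 = "shear B / bend B"
  have k: "0 \<le> ?k1" "0 \<le> ?k2" "0 \<le> ?k3" using params by (auto simp: beam_params_def)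
  have bw: "\<bar>w'' y t\<bar> \<le> (?k1 * C + C) * exp (\<sigma> * t)" if "y \<in> {0..len B} - {pos B}" "t \<ge> 0" for y t
  proof -
    have "\<bar>w'' y t\<bar> \<le> \<bar>?k1 * dt (dt (w y)) t\<bar> + \<bar>\<psi>' y t\<bar>"
      unfolding second_x_derivatives [OF that(2,1)] by (rule abs_triangle_ineq)
    also have "\<dots> = ?k1 * \<bar>dt (dt (w y)) t\<bar> + \<bar>\<psi>' y t\<bar>"
      using k by (simp only: abs_mult abs_of_nonneg)
    also have "\<dots> \<le> ?k1 * (C * exp (\<sigma> * t)) + C * exp (\<sigma> * t)"
      using growth_t [of w t y] \<psi>_derivative_everywhere(3) [of t y] that k
      by (intro add_mono mult_left_mono) auto
    finally show ?thesis by (simp add: algebra_simps)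
  qed
  have b\<psi>: "\<bar>\<psi>'' y t\<bar> \<le> (?k2 * C + ?k3 * (C + C)) * exp (\<sigma> * t)" if "y \<in> {0..len B} - {pos B}" "t \<ge> 0" for y t
  proof -
    have "\<bar>\<psi>'' y t\<bar> \<le> \<bar>?k2 * dt (dt (\<psi> y)) t\<bar> + \<bar>?k3 * (w' y t - \<psi> y t)\<bar>"
      unfolding second_x_derivatives [OF that(2,1)] by (rule abs_triangle_ineq4)
    also have "\<dots> = ?k2 * \<bar>dt (dt (\<psi> y)) t\<bar> + ?k3 * \<bar>w' y t - \<psi> y t\<bar>"
      using k by (simp only: abs_mult abs_of_nonneg)
    also have "\<dots> \<le> ?k2 * (C * exp (\<sigma> * t)) + ?k3 * (C * exp (\<sigma> * t) + C * exp (\<sigma> * t))"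
      using growth_t [of \<psi> t y] growth_x [of w t y] that k
      by (intro add_mono mult_left_mono order_trans [OF abs_triangle_ineq4]) (auto simp: w'_def)
    finally show ?thesis by (simp add: algebra_simps)
  qed
  have "((\<lambda>\<xi>. laplace s (w' \<xi>)) has_vector_derivative laplace s (w'' x)) (at x within {0..len B})"
    by (rule laplace_x_derivative(2) [OF assms transform_w'(1) x_derivatives(3) bw])
  moreover have "laplace s (w'' x) = of_real ?k1 * (s\<^sup>2 * W x) + laplace s (\<psi>' x)"
    by (rule laplace_unique, rule has_laplace_cong [OF second_x_derivatives(1) [OF _ assms, symmetric]],
        assumption, intro has_laplace_add has_laplace_cmult time_transforms transform_\<psi>' x)
  ultimately show "((\<lambda>\<xi>. laplace s (w' \<xi>)) has_vector_derivative
        of_real (rho B) / of_real (shear B) * s\<^sup>2 * W x + laplace s (\<psi>' x)) (at x within {0..len B})"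
    by (simp add: mult.assoc)
  have "((\<lambda>\<xi>. laplace s (\<psi>' \<xi>)) has_vector_derivative laplace s (\<psi>'' x)) (at x within {0..len B})"
    by (rule laplace_x_derivative(2) [OF assms transform_\<psi>'(1) x_derivatives(4) b\<psi>]) auto
  moreover have "laplace s (\<psi>'' x) = of_real ?k2 * (s\<^sup>2 * \<Psi> x) - of_real ?k3 * (laplace s (w' x) - \<Psi> x)"
    by (rule laplace_unique, rule has_laplace_cong [OF second_x_derivatives(2) [OF _ assms, symmetric]],
        assumption, intro has_laplace_diff has_laplace_cmult time_transforms transform_w' x assms)
  ultimately show "((\<lambda>\<xi>. laplace s (\<psi>' \<xi>)) has_vector_derivative
        of_real (Irho B) / of_real (bend B) * s\<^sup>2 * \<Psi> x
          - of_real (shear B) / of_real (bend B) * (laplace s (w' x) - \<Psi> x)) (at x within {0..len B})"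
    by (simp add: mult.assoc)
qed

lemma dx_W: "x \<in> {0..len B} - {pos B} \<Longrightarrow> dx B W x = laplace s (w' x)"
  using geometry by (intro dx_eqI transform_w') auto

lemma dx_\<Psi>: "x \<in> {0..len B} \<Longrightarrow> dx B \<Psi> x = laplace s (\<psi>' x)"
  using geometry by (intro dx_eqI transform_\<psi>') auto

text \<open>The derivative \<open>dx B f\<close> need not equal \<open>g\<close> at the position of the force, but that point has positive
distance from \<open>x\<close>.\<close>

lemma dx_derivative:
  assumes "x \<in> {0..len B} - {pos B}"
    and f: "\<And>y. y \<in> {0..len B} - {pos B} \<Longrightarrow> dx B f y = g y"
    and g: "(g has_vector_derivative D) (at x within {0..len B})"
  shows "(dx B f has_vector_derivative D) (at x within {0..len B})"
  using g
proof (rule has_vector_derivative_transform_within)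
  show "0 < \<bar>x - pos B\<bar>" "x \<in> {0..len B}" using assms(1) by auto
  fix y assume "y \<in> {0..len B}" "dist y x < \<bar>x - pos B\<bar>"
  then show "g y = dx B f y" using f [of y] by (auto simp: dist_real_def)
qed

lemma transform_one_sided_limit:
  assumes T: "T \<subseteq> {0..len B} - {pos B}" and nontriv: "at (pos B) within T \<noteq> bot"
    and lim: "\<And>t. t \<ge> 0 \<Longrightarrow> ((\<lambda>x. w' x t) \<longlongrightarrow> p t) (at (pos B) within T)"
  shows "has_laplace p s (laplace s p)" and "(dx B W \<longlongrightarrow> laplace s p) (at (pos B) within T)"
proof -
  have *: "y \<in> T - {pos B} \<Longrightarrow> has_laplace (w' y) s (laplace s (w' y))"
    "y \<in> T - {pos B} \<Longrightarrow> t \<ge> 0 \<Longrightarrow> \<bar>w' y t\<bar> \<le> C * exp (\<sigma> * t)" for y t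
    using transform_w'(1) growth_x [of w t y] T by (auto simp: w'_def)
  show "has_laplace p s (laplace s p)"
    by (rule laplace_dominated_convergence(1) [OF rate nontriv * lim])
  have "((\<lambda>y. laplace s (w' y)) \<longlongrightarrow> laplace s p) (at (pos B) within T)"
    by (rule laplace_dominated_convergence(2) [OF rate nontriv * lim])
  then show "(dx B W \<longlongrightarrow> laplace s p) (at (pos B) within T)"
    by (rule Lim_transform_within [of _ _ _ _ 1]) (use T in \<open>auto simp: dx_W\<close>)
qed

text \<open>Every condition of the control system is carried over by one of the interchange lemmas.  The growth
hypotheses do not concern the input; its Laplace integral converges because the force balance expresses
\<open>F0\<close> through transformable functions, among them the one-sided limits of \<open>w'\<close>.\<close>

lemma transforms_solve_transformed_system:
  "\<exists>U. has_laplace F0 s U \<and> transformed_system B s U W \<Psi>"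
proof -
  have pos: "pos B \<in> {0..len B}" using geometry by auto
  have l: "0 \<in> {0..len B} - {pos B}" "len B \<in> {0..len B} - {pos B}" using geometry by auto
  have at_pos: "at (pos B) within {0..len B} = at (pos B)"
    using geometry by (simp add: at_within_Icc_at)
  obtain p q where p: "\<And>t. t \<ge> 0 \<Longrightarrow> ((\<lambda>x. w' x t) \<longlongrightarrow> p t) (at_left (pos B))"
    and q: "\<And>t. t \<ge> 0 \<Longrightarrow> ((\<lambda>x. w' x t) \<longlongrightarrow> q t) (at_right (pos B))"
    and force: "\<And>t. t \<ge> 0 \<Longrightarrow> F0 t - mass B * dt (dt (w (pos B))) t - spring B * w (pos B) t
             - damp B * dt (w (pos B)) t - shear B * (p t - q t) = 0"
    using system(8) by metis
  have left: "at (pos B) within {0..<pos B} = at_left (pos B)" and right: "at (pos B) within {pos B<..len B} = at_right (pos B)"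
    using geometry by (auto intro!: at_within_nhd [of _ "{0<..<len B}"])
  have subL: "{0..<pos B} \<subseteq> {0..len B} - {pos B}" and subR: "{pos B<..len B} \<subseteq> {0..len B} - {pos B}"
    using geometry by auto
  have P: "has_laplace p s (laplace s p)" "(dx B W \<longlongrightarrow> laplace s p) (at_left (pos B))"
    using transform_one_sided_limit [OF subL, of p] p unfolding left by auto
  have Q: "has_laplace q s (laplace s q)" "(dx B W \<longlongrightarrow> laplace s q) (at_right (pos B))"
    using transform_one_sided_limit [OF subR, of q] q unfolding right by auto
  define U where "U = of_real (mass B) * (s\<^sup>2 * W (pos B)) + of_real (spring B) * W (pos B)
      + of_real (damp B) * (s * W (pos B)) + of_real (shear B) * (laplace s p - laplace s q)"
  have "has_laplace (\<lambda>t. mass B * dt (dt (w (pos B))) t + spring B * w (pos B) t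
      + damp B * dt (w (pos B)) t + shear B * (p t - q t)) s U"
    unfolding U_def by (intro has_laplace_add has_laplace_diff has_laplace_cmult time_transforms P Q pos)
  then have F0: "has_laplace F0 s U"
    by (rule has_laplace_cong [rotated]) (use force in \<open>auto simp: algebra_simps\<close>)
  have zero_fun: "laplace s f = 0" if "\<And>t. t \<ge> 0 \<Longrightarrow> f t = 0" for f
  proof (rule laplace_unique)
    show "has_laplace f s 0" unfolding has_laplace_def by (rule has_integral_eq [OF _ has_integral_0]) (use that in auto)
  qed
  have dd: "(dx B W has_vector_derivative of_real (rho B) / of_real (shear B) * s\<^sup>2 * W x + dx B \<Psi> x) (at x within {0..len B})"
    "(dx B \<Psi> has_vector_derivative of_real (Irho B) / of_real (bend B) * s\<^sup>2 * \<Psi> x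
          - of_real (shear B) / of_real (bend B) * (dx B W x - \<Psi> x)) (at x within {0..len B})"
    if "x \<in> {0..len B} - {pos B}" for x
    using dx_derivative [OF that dx_W second_transforms(1) [OF that]]
      dx_derivative [OF that dx_\<Psi> second_transforms(2) [OF that]] dx_W [OF that] dx_\<Psi> [of x] that
    by simp_all
  have nz: "complex_of_real (shear B) \<noteq> 0" "complex_of_real (bend B) \<noteq> 0"
    using constants by auto
  have "transformed_system B s U W \<Psi>"
    unfolding transformed_system_def
  proof (intro conjI ballI)
    show "twice_diff_off_pos B W"
      unfolding twice_diff_off_pos_def
      by (intro ballI conjI; rule differentiableI_vector; erule transform_w'(2) dd(1))
    show "twice_diff_off_pos B \<Psi>"
      unfolding twice_diff_off_pos_def
      by (intro ballI conjI; rule differentiableI_vector; (erule dd(2) | rule transform_\<psi>'(2), simp))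
    fix x assume x: "x \<in> {0..len B} - {pos B}"
    then have x': "x \<in> {0..len B}" by simp
    show "of_real (shear B) * (dx B (dx B W) x - dx B \<Psi> x) - of_real (rho B) * s\<^sup>2 * W x = 0"
      unfolding dx_eqI [OF geometry(1) x' dd(1) [OF x]] using nz by (simp add: field_simps)
    show "of_real (bend B) * dx B (dx B \<Psi>) x + of_real (shear B) * (dx B W x - \<Psi> x)
          - of_real (Irho B) * s\<^sup>2 * \<Psi> x = 0"
      unfolding dx_eqI [OF geometry(1) x' dd(2) [OF x]] using nz by (simp add: field_simps)
  next
    show "W 0 = 0" "W (len B) = 0"
      by (rule zero_fun, erule system)+
    show "dx B \<Psi> 0 = 0" "dx B \<Psi> (len B) = 0"
      using zero_fun [OF system(5)] zero_fun [OF system(6)] dx_\<Psi> l by auto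
    have "(W \<longlongrightarrow> W (pos B)) (at (pos B) within {0..len B})"
    proof (rule laplace_dominated_convergence(2) [OF rate nontrivial [OF pos], of _ C])
      fix t :: real assume "t \<ge> 0"
      then show "((\<lambda>y. w y t) \<longlongrightarrow> w (pos B) t) (at (pos B) within {0..len B})"
        using system(1) pos by (auto simp: continuous_on_def)
    qed (use time_transforms growth_t [of w] in auto)
    then show "isCont W (pos B)" by (simp add: at_pos isCont_def)
    show "isCont \<Psi> (pos B)"
      using has_vector_derivative_continuous [OF transform_\<psi>'(2) [OF pos]] by (simp add: at_pos)
    have "((\<lambda>x. laplace s (\<psi>' x)) \<longlongrightarrow> laplace s (\<psi>' (pos B))) (at (pos B) within {0..len B})"
      by (rule laplace_dominated_convergence(2) [OF rate nontrivial [OF pos], of _ C])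
        (use transform_\<psi>'(1) \<psi>_derivative_everywhere(2,3) pos in \<open>auto simp: at_pos\<close>)
    then have "(dx B \<Psi> \<longlongrightarrow> dx B \<Psi> (pos B)) (at (pos B) within {0..len B})"
      unfolding dx_\<Psi> [OF pos] by (rule Lim_transform_within [of _ _ _ _ 1]) (auto simp: dx_\<Psi>)
    then show "isCont (dx B \<Psi>) (pos B)" by (simp add: at_pos isCont_def)
    show "\<exists>p q. (dx B W \<longlongrightarrow> p) (at_left (pos B)) \<and> (dx B W \<longlongrightarrow> q) (at_right (pos B)) \<and>
        of_real (shear B) * (p - q)
          + (of_real (mass B) * s\<^sup>2 + of_real (spring B) + of_real (damp B) * s) * W (pos B) = U"
      using P(2) Q(2) by (intro exI conjI) (auto simp: U_def algebra_simps)
  qed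
  with F0 show ?thesis by blast
qed

end

text \<open>A growth bound may be weakened, so that the bounds for \<open>w\<close> and \<open>\<psi>\<close> can be merged by
taking maxima of the constants and of the rates.\<close>

lemma laplace_growth_mono:
  assumes "laplace_growth B s f"
  obtains C \<sigma> where "\<sigma> < Re s" "\<And>C' \<sigma>' t x. \<lbrakk>C \<le> C'; \<sigma> \<le> \<sigma>'; t \<ge> 0; x \<in> {0..len B}\<rbrakk> \<Longrightarrow>
      \<bar>f x t\<bar> \<le> C' * exp (\<sigma>' * t) \<and> \<bar>dt (f x) t\<bar> \<le> C' * exp (\<sigma>' * t) \<and> \<bar>dt (dt (f x)) t\<bar> \<le> C' * exp (\<sigma>' * t)"
    "\<And>C' \<sigma>' t x. \<lbrakk>C \<le> C'; \<sigma> \<le> \<sigma>'; t \<ge> 0; x \<in> {0..len B} - {pos B}\<rbrakk> \<Longrightarrow>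
      \<bar>dx B (\<lambda>\<xi>. f \<xi> t) x\<bar> \<le> C' * exp (\<sigma>' * t)"
proof -
  obtain C \<sigma> where *: "\<sigma> < Re s" "\<And>t x. \<lbrakk>t \<ge> 0; x \<in> {0..len B}\<rbrakk> \<Longrightarrow>
      \<bar>f x t\<bar> \<le> C * exp (\<sigma> * t) \<and> \<bar>dt (f x) t\<bar> \<le> C * exp (\<sigma> * t) \<and> \<bar>dt (dt (f x)) t\<bar> \<le> C * exp (\<sigma> * t)"
    "\<And>t x. \<lbrakk>t \<ge> 0; x \<in> {0..len B} - {pos B}\<rbrakk> \<Longrightarrow> \<bar>dx B (\<lambda>\<xi>. f \<xi> t) x\<bar> \<le> C * exp (\<sigma> * t)"
    using assms unfolding laplace_growth_def by blast
  have mono: "u \<le> C' * exp (\<sigma>' * t)"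
    if "\<bar>v\<bar> \<le> C * exp (\<sigma> * t)" "u = \<bar>v\<bar>" "C \<le> C'" "\<sigma> \<le> \<sigma>'" "t \<ge> 0" for u v C' \<sigma>' t
  proof -
    \<comment> \<open>Enlarging the rate needs a nonnegative constant, which the bound itself enforces.\<close>
    have "0 \<le> C" using that(1) by (meson abs_ge_zero exp_gt_zero order_trans zero_le_mult_iff not_less)
    then have "C * exp (\<sigma> * t) \<le> C' * exp (\<sigma>' * t)"
      using that by (intro mult_mono) (auto intro: mult_right_mono)
    with that show ?thesis by linarith
  qed
  show ?thesis
    by (rule that [OF *(1)]) (use *(2,3) mono in blast)+
qed

lemma transformable_trajectoryI:
  assumes "beam_params B" "control_system B F0 w \<psi>" "zero_initial B w \<psi>"
    and w: "laplace_growth B s w" and \<psi>: "laplace_growth B s \<psi>"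
  obtains C \<sigma> where "transformable_trajectory B F0 w \<psi> s C \<sigma>"
proof -
  obtain C\<^sub>1 \<sigma>\<^sub>1 where 1: "\<sigma>\<^sub>1 < Re s" "\<And>C' \<sigma>' t x. \<lbrakk>C\<^sub>1 \<le> C'; \<sigma>\<^sub>1 \<le> \<sigma>'; t \<ge> 0; x \<in> {0..len B}\<rbrakk> \<Longrightarrow>
      \<bar>w x t\<bar> \<le> C' * exp (\<sigma>' * t) \<and> \<bar>dt (w x) t\<bar> \<le> C' * exp (\<sigma>' * t) \<and> \<bar>dt (dt (w x)) t\<bar> \<le> C' * exp (\<sigma>' * t)"
    "\<And>C' \<sigma>' t x. \<lbrakk>C\<^sub>1 \<le> C'; \<sigma>\<^sub>1 \<le> \<sigma>'; t \<ge> 0; x \<in> {0..len B} - {pos B}\<rbrakk> \<Longrightarrow>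
      \<bar>dx B (\<lambda>\<xi>. w \<xi> t) x\<bar> \<le> C' * exp (\<sigma>' * t)"
    using laplace_growth_mono [OF w] by metis
  obtain C\<^sub>2 \<sigma>\<^sub>2 where 2: "\<sigma>\<^sub>2 < Re s" "\<And>C' \<sigma>' t x. \<lbrakk>C\<^sub>2 \<le> C'; \<sigma>\<^sub>2 \<le> \<sigma>'; t \<ge> 0; x \<in> {0..len B}\<rbrakk> \<Longrightarrow>
      \<bar>\<psi> x t\<bar> \<le> C' * exp (\<sigma>' * t) \<and> \<bar>dt (\<psi> x) t\<bar> \<le> C' * exp (\<sigma>' * t) \<and> \<bar>dt (dt (\<psi> x)) t\<bar> \<le> C' * exp (\<sigma>' * t)"
    "\<And>C' \<sigma>' t x. \<lbrakk>C\<^sub>2 \<le> C'; \<sigma>\<^sub>2 \<le> \<sigma>'; t \<ge> 0; x \<in> {0..len B} - {pos B}\<rbrakk> \<Longrightarrow>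
      \<bar>dx B (\<lambda>\<xi>. \<psi> \<xi> t) x\<bar> \<le> C' * exp (\<sigma>' * t)"
    using laplace_growth_mono [OF \<psi>] by metis
  have "transformable_trajectory B F0 w \<psi> s (max C\<^sub>1 C\<^sub>2) (max \<sigma>\<^sub>1 \<sigma>\<^sub>2)"
  proof
    show "max \<sigma>\<^sub>1 \<sigma>\<^sub>2 < Re s" using 1(1) 2(1) by simp
  qed (use assms 1(2,3) 2(2,3) in \<open>auto\<close>)
  then show ?thesis by (rule that)
qed

section \<open>The transfer function\<close>

text \<open>Both parts of the notion of a transfer function follow from the frequency domain alone, once the
output of a trajectory is known to transform into the corresponding output of the transforms, as
these solve the transformed system.\<close>

lemma has_transfer_valueI:
  assumes B: "beam_params B" and M: "det (M_mat B s) \<noteq> 0"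
    and freq: "\<And>U W \<Psi>. transformed_system B s U W \<Psi> \<Longrightarrow> Y W \<Psi> = H * U"
    and time: "\<And>F0 w \<psi> C \<sigma>. transformable_trajectory B F0 w \<psi> s C \<sigma> \<Longrightarrow>
      has_laplace (y w \<psi>) s (Y (\<lambda>x. laplace s (w x)) (\<lambda>x. laplace s (\<psi> x)))"
  shows "has_transfer_value B y Y s H"
  unfolding has_transfer_value_def
proof (intro conjI allI impI)
  show "\<exists>W \<Psi>. transformed_system B s U W \<Psi>" for U
    by (rule transformed_system_exists [OF B M])
  show "H = Y W \<Psi> / U" if "U \<noteq> 0 \<and> transformed_system B s U W \<Psi>" for U W \<Psi>
    using freq [of U W \<Psi>] that by simp
  fix F0 w \<psi>
  assume "control_system B F0 w \<psi> \<and> zero_initial B w \<psi> \<and> laplace_growth B s w \<and> laplace_growth B s \<psi>"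
  then obtain C \<sigma> where traj: "transformable_trajectory B F0 w \<psi> s C \<sigma>"
    using transformable_trajectoryI [OF B] by blast
  then obtain U where "has_laplace F0 s U"
    and "transformed_system B s U (\<lambda>x. laplace s (w x)) (\<lambda>x. laplace s (\<psi> x))"
    using transformable_trajectory.transforms_solve_transformed_system by blast
  then show "\<exists>U V. has_laplace F0 s U \<and> has_laplace (y w \<psi>) s V \<and> (U \<noteq> 0 \<longrightarrow> H = V / U)"
    using time [OF traj] freq by (intro exI conjI impI) (assumption, assumption, simp)
qed

text \<open>Multiplying the interface equations by the inverse matrix leaves \<open>U\<close> times its fourth column,
because the jump of \<open>W'\<close> is the only inhomogeneous condition.\<close>

lemma transformed_system_outputs:
  assumes B: "beam_params B" and M: "det (M_mat B s) \<noteq> 0" and sys: "transformed_system B s U W \<Psi>"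
    and lk: "0 \<le> lk" "lk \<le> len B"
  defines "N \<equiv> matrix_inv (M_mat B s)"
  shows "W lk = (if lk \<le> pos B
            then E_mat B s lk $ 1 $ 2 * N $ 1 $ 4 + E_mat B s lk $ 1 $ 3 * N $ 2 $ 4
            else E_mat B s (lk - len B) $ 1 $ 2 * N $ 3 $ 4 + E_mat B s (lk - len B) $ 1 $ 3 * N $ 4 $ 4) * U"
    and "dx B \<Psi> lk = (if lk \<le> pos B
            then E_mat B s lk $ 4 $ 2 * N $ 1 $ 4 + E_mat B s lk $ 4 $ 3 * N $ 2 $ 4
            else E_mat B s (lk - len B) $ 4 $ 2 * N $ 3 $ 4 + E_mat B s (lk - len B) $ 4 $ 3 * N $ 4 $ 4) * U"
proof -
  let ?v = "vector [dx B W 0, \<Psi> 0, dx B W (len B), \<Psi> (len B)] :: complex^4"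
  note sol = transformed_system_solution [OF B sys]
  have "N ** M_mat B s = mat 1"
    using M by (simp add: N_def invertible_mult_matrix_inv invertible_det_nz)
  then have "?v = N *v (M_mat B s *v ?v)"
    by (simp only: matrix_vector_mul_assoc matrix_vector_mul_lid)
  also have "\<dots> = N *v vector [0, 0, 0, U]"
    by (simp only: sol(1))
  finally have "?v $ i = (N *v vector [0, 0, 0, U]) $ i" for i
    by (rule arg_cong)
  then have v: "?v $ i = N $ i $ 4 * U" for i
    unfolding mat_vec_mult_4 by (simp only: vector_4 mult_zero_right add_0)
  show "W lk = (if lk \<le> pos B
            then E_mat B s lk $ 1 $ 2 * N $ 1 $ 4 + E_mat B s lk $ 1 $ 3 * N $ 2 $ 4
            else E_mat B s (lk - len B) $ 1 $ 2 * N $ 3 $ 4 + E_mat B s (lk - len B) $ 1 $ 3 * N $ 4 $ 4) * U"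
    using sol(2) [of lk] sol(4) [of lk] lk unfolding v by (auto simp: algebra_simps)
  show "dx B \<Psi> lk = (if lk \<le> pos B
            then E_mat B s lk $ 4 $ 2 * N $ 1 $ 4 + E_mat B s lk $ 4 $ 3 * N $ 2 $ 4
            else E_mat B s (lk - len B) $ 4 $ 2 * N $ 3 $ 4 + E_mat B s (lk - len B) $ 4 $ 3 * N $ 4 $ 4) * U"
    using sol(3) [of lk] sol(5) [of lk] lk unfolding v by (auto simp: algebra_simps)
qed

theorem proposition2p1:
  fixes B :: beam and lk :: real and s :: complex
  assumes "beam_params B"
    and "0 \<le> lk" and "lk \<le> len B"
    and "s \<in> S_set B"
  shows "has_transfer_value B (\<lambda>w \<psi> t. w lk t) (\<lambda>W \<Psi>. W lk) s
           (if lk \<le> pos B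
            then E_mat B s lk $ 1 $ 2 * matrix_inv (M_mat B s) $ 1 $ 4
               + E_mat B s lk $ 1 $ 3 * matrix_inv (M_mat B s) $ 2 $ 4
            else E_mat B s (lk - len B) $ 1 $ 2 * matrix_inv (M_mat B s) $ 3 $ 4
               + E_mat B s (lk - len B) $ 1 $ 3 * matrix_inv (M_mat B s) $ 4 $ 4) \<and>
         has_transfer_value B (\<lambda>w \<psi> t. dx B (\<lambda>x. \<psi> x t) lk) (\<lambda>W \<Psi>. dx B \<Psi> lk) s
           (if lk \<le> pos B
            then E_mat B s lk $ 4 $ 2 * matrix_inv (M_mat B s) $ 1 $ 4
               + E_mat B s lk $ 4 $ 3 * matrix_inv (M_mat B s) $ 2 $ 4
            else E_mat B s (lk - len B) $ 4 $ 2 * matrix_inv (M_mat B s) $ 3 $ 4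
               + E_mat B s (lk - len B) $ 4 $ 3 * matrix_inv (M_mat B s) $ 4 $ 4)"
proof
  have M: "det (M_mat B s) \<noteq> 0" using assms(4) by (simp add: S_set_def)
  note outputs = transformed_system_outputs [OF assms(1) M _ assms(2,3)]
  have lk: "lk \<in> {0..len B}" using assms(2,3) by simp
  show "has_transfer_value B (\<lambda>w \<psi> t. w lk t) (\<lambda>W \<Psi>. W lk) s
           (if lk \<le> pos B
            then E_mat B s lk $ 1 $ 2 * matrix_inv (M_mat B s) $ 1 $ 4
               + E_mat B s lk $ 1 $ 3 * matrix_inv (M_mat B s) $ 2 $ 4
            else E_mat B s (lk - len B) $ 1 $ 2 * matrix_inv (M_mat B s) $ 3 $ 4
               + E_mat B s (lk - len B) $ 1 $ 3 * matrix_inv (M_mat B s) $ 4 $ 4)"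
    by (rule has_transfer_valueI [OF assms(1) M])
      (erule outputs(1), erule transformable_trajectory.time_transforms(1) [OF _ lk])
  show "has_transfer_value B (\<lambda>w \<psi> t. dx B (\<lambda>x. \<psi> x t) lk) (\<lambda>W \<Psi>. dx B \<Psi> lk) s
           (if lk \<le> pos B
            then E_mat B s lk $ 4 $ 2 * matrix_inv (M_mat B s) $ 1 $ 4
               + E_mat B s lk $ 4 $ 3 * matrix_inv (M_mat B s) $ 2 $ 4
            else E_mat B s (lk - len B) $ 4 $ 2 * matrix_inv (M_mat B s) $ 3 $ 4
               + E_mat B s (lk - len B) $ 4 $ 3 * matrix_inv (M_mat B s) $ 4 $ 4)"
  proof (rule has_transfer_valueI [OF assms(1) M])
    fix F0 w \<psi> C \<sigma>
    assume "transformable_trajectory B F0 w \<psi> s C \<sigma>"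
    then interpret transformable_trajectory B F0 w \<psi> s C \<sigma> .
    show "has_laplace (\<lambda>t. dx B (\<lambda>x. \<psi> x t) lk) s (dx B (\<lambda>x. laplace s (\<psi> x)) lk)"
      unfolding dx_\<Psi> [OF lk]
      by (rule has_laplace_cong [OF _ transform_\<psi>'(1) [OF lk]]) (simp add: \<psi>'_def)
  qed (erule outputs(2))
qed

end
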